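(* Let $X$ be any fat point subscheme of $\mathbb{P}^n$. Then $r(X) \le \operatorname{Seg}(X)$, where $r(X)$ is the regularity index of $X$ and $\operatorname{Seg}(X)$ is its Segre bound.
   Context: $K$ is an arbitrary field, $n\ge 1$, $\mathbb{P}^n=\mathbb{P}^n_K$ with coordinate ring $R=K[x_0,\dots,x_n]$ (standard grading); points of $\mathbb{P}^n$ are represented by nonzero vectors of $K^{n+1}$. For a point $P$, $I_P\subset R$ is its homogeneous ideal. A fat point scheme $X=\sum_{i=1}^s m_iP_i$ is given by distinct points $P_1,\dots,P_s\in\mathbb{P}^n$ ($s\ge1$) and positive integers $m_1,\dots,m_s$; it is the zero-dimensional subscheme defined by the homogeneous ideal $I_X=\bigcap_{i=1}^s I_{P_i}^{m_i}$, and $\deg X=\sum_{i=1}^s\binom{m_i+n-1}{n}$. Its Hilbert function is $h_X(j)=\dim_K[R/I_X]_j$. The regularity index $r(X)$ is the least integer $j$ such that $h_X(j)=\deg X$ (equality then holds for all larger degrees). For a linear subspace $L\subseteq\mathbb{P}^n$ the weight is $w_L(X)=\sum_{P_i\in L}m_i$. The Segre bound is $$\operatorname{Seg}(X)=\max\left\{\left\lceil\frac{w_L(X)-1}{\dim L}\right\rceil \;\Big|\; L\subseteq\mathbb{P}^n\text{ a linear subspace with }\dim L\ge1\right\}.$$ *)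

theory Defs
  imports
    "HOL-Analysis.Cartesian_Space"
    "HOL-Library.Poly_Mapping"
    "HOL-Algebra.Ideal_Product"
    "HOL-Algebra.QuotRing"
    "HOL-Algebra.Embedded_Algebras"
begin

text \<open>
  The variables \<open>x\<^sub>0, \<dots>, x\<^sub>n\<close> are indexed by a finite type \<open>'v\<close>, so that \<open>n = CARD('v) - 1\<close>.
  A polynomial is a finitely supported map from exponent vectors \<open>'v \<Rightarrow>\<^sub>0 nat\<close> to coefficients
  (with the convolution product of \<^theory>\<open>HOL-Library.Poly_Mapping\<close>), and a point of
  projective \<open>n\<close>-space is given by a nonzero vector of type \<open>'k ^ 'v\<close>.
\<close>

type_synonym ('v, 'k) mpoly = "('v \<Rightarrow>\<^sub>0 nat) \<Rightarrow>\<^sub>0 'k"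

definition coord_ring :: "('v::finite, 'k::field) mpoly ring" where
  "coord_ring = \<lparr>carrier = UNIV, mult = (*), one = 1, zero = 0, add = (+)\<rparr>"

lemma coord_ring_cring: "cring (coord_ring :: ('v::finite, 'k::field) mpoly ring)"
proof (rule cringI)
  show "abelian_group (coord_ring :: ('v, 'k) mpoly ring)"
  proof (rule abelian_groupI)
    fix x :: "('v, 'k) mpoly"
    show "\<exists>y\<in>carrier coord_ring. y \<oplus>\<^bsub>coord_ring\<^esub> x = \<zero>\<^bsub>coord_ring\<^esub>"
      by (rule bexI[of _ "- x"]) (simp_all add: coord_ring_def)
  qed (simp_all add: coord_ring_def algebra_simps)
  show "comm_monoid (coord_ring :: ('v, 'k) mpoly ring)"
    by (rule comm_monoidI) (simp_all add: coord_ring_def algebra_simps)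
qed (simp add: coord_ring_def algebra_simps)

definition mpoly_eval :: "('v::finite, 'k::field) mpoly \<Rightarrow> 'k ^ 'v \<Rightarrow> 'k" where
  "mpoly_eval f p =
     (\<Sum>t\<in>Poly_Mapping.keys f.
        Poly_Mapping.lookup f t * (\<Prod>v\<in>UNIV. (p $ v) ^ Poly_Mapping.lookup t v))"

text \<open>The zero polynomial belongs to every graded component.\<close>

definition homogeneous_part :: "nat \<Rightarrow> ('v::finite, 'k::field) mpoly set" where
  "homogeneous_part d =
     {f. \<forall>t\<in>Poly_Mapping.keys f. (\<Sum>v\<in>UNIV. Poly_Mapping.lookup t v) = d}"

definition point_ideal :: "'k::field ^ 'v::finite \<Rightarrow> ('v, 'k) mpoly set" where
  "point_ideal p =
     Idl\<^bsub>coord_ring\<^esub> {f. (\<exists>d. f \<in> homogeneous_part d) \<and> mpoly_eval f p = 0}"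

definition same_point :: "'k::field ^ 'v::finite \<Rightarrow> 'k ^ 'v \<Rightarrow> bool" where
  "same_point p q \<longleftrightarrow> (\<exists>c. c \<noteq> 0 \<and> q = c *s p)"

text \<open>
  A fat point scheme \<open>m\<^sub>1 P\<^sub>1 + \<dots> + m\<^sub>s P\<^sub>s\<close> is given by \<open>s\<close>, the representing vectors \<open>P i\<close> and the
  multiplicities \<open>m i\<close>; only the indices \<open>1 \<le> i \<le> s\<close> matter.
\<close>

definition fat_point_scheme :: "nat \<Rightarrow> (nat \<Rightarrow> 'k::field ^ 'v::finite) \<Rightarrow> (nat \<Rightarrow> nat) \<Rightarrow> bool" where
  "fat_point_scheme s P m \<longleftrightarrow>
     1 \<le> s \<and> (\<forall>i\<in>{1..s}. P i \<noteq> 0 \<and> 1 \<le> m i) \<and>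
     (\<forall>i\<in>{1..s}. \<forall>j\<in>{1..s}. i \<noteq> j \<longrightarrow> \<not> same_point (P i) (P j))"

text \<open>Powers of ideals are taken in the multiplicative monoid of ideals.\<close>

definition fat_ideal ::
    "nat \<Rightarrow> (nat \<Rightarrow> 'k::field ^ 'v::finite) \<Rightarrow> (nat \<Rightarrow> nat) \<Rightarrow> ('v, 'k) mpoly set" where
  "fat_ideal s P m = (\<Inter>i\<in>{1..s}. point_ideal (P i) [^]\<^bsub>ideals_set coord_ring\<^esub> m i)"

text \<open>
  In \<open>R/I\<close> for \<open>I\<close> homogeneous, the copy of \<open>K\<close> consists of the classes of the constants, and the
  component of degree \<open>j\<close> consists of the classes of the forms of degree \<open>j\<close>.
\<close>

definition hilbert_function :: "('v::finite, 'k::field) mpoly set \<Rightarrow> nat \<Rightarrow> nat" where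
  "hilbert_function I j =
     (ring.dim (coord_ring Quot I)
        over ((\<lambda>c. I +>\<^bsub>coord_ring\<^esub> Poly_Mapping.single 0 c) ` UNIV))
       ((\<lambda>f. I +>\<^bsub>coord_ring\<^esub> f) ` homogeneous_part j)"

definition fat_degree :: "nat \<Rightarrow> nat \<Rightarrow> (nat \<Rightarrow> nat) \<Rightarrow> nat" where
  "fat_degree n s m = (\<Sum>i\<in>{1..s}. (m i + n - 1) choose n)"

text \<open>
  It suffices to consider \<open>j \<ge> 0\<close>: in negative degrees the Hilbert function vanishes, whereas the
  degree of a fat point scheme is positive.
\<close>

definition regularity_index ::
    "nat \<Rightarrow> (nat \<Rightarrow> 'k::field ^ 'v::finite) \<Rightarrow> (nat \<Rightarrow> nat) \<Rightarrow> nat" where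
  "regularity_index s P m =
     (LEAST j. hilbert_function (fat_ideal s P m) j = fat_degree (CARD('v) - 1) s m)"

definition weight ::
    "('k::field ^ 'v::finite) set \<Rightarrow> nat \<Rightarrow> (nat \<Rightarrow> 'k ^ 'v) \<Rightarrow> (nat \<Rightarrow> nat) \<Rightarrow> nat" where
  "weight L s P m = (\<Sum>i\<in>{i\<in>{1..s}. P i \<in> L}. m i)"

text \<open>
  A projective linear subspace of dimension \<open>d\<close> is given by its cone \<open>L\<close>, a vector subspace of
  dimension \<open>d + 1\<close>. The value is an integer since the quotient is negative when \<open>w\<^sub>L = 0\<close>.
  The set below is finite, and nonempty when \<open>CARD('v) \<ge> 2\<close>.
\<close>

definition segre_bound :: "nat \<Rightarrow> (nat \<Rightarrow> 'k::field ^ 'v::finite) \<Rightarrow> (nat \<Rightarrow> nat) \<Rightarrow> int" where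
  "segre_bound s P m =
     Max {\<lceil>(real (weight L s P m) - 1) / (real (vec.dim L) - 1)\<rceil> | L.
            vec.subspace L \<and> vec.dim L \<ge> 2}"

end

theory Submission
  imports Defs
begin

text \<open>
  Write \<open>B\<close> for the Segre bound, \<open>V = K\<^sup>n\<^sup>+\<^sup>1\<close>, and \<open>R\<^sub>B\<close> for the forms of degree \<open>B\<close>. It suffices that the
  Hilbert function has reached the degree of the scheme at \<open>B\<close>. As \<open>R\<^sub>B / (I\<^sub>P\<^sup>m)\<^sub>B\<close> has dimension
  \<open>(m + n - 1) choose n\<close> when \<open>m \<le> B + 1\<close>, the Chinese remainder principle reduces this to showing, for
  each point \<open>P = P\<^sub>i\<close>, that the degree \<open>B\<close> parts of \<open>I\<^sub>P\<^sup>m\<close> and of \<open>J\<close> together span \<open>R\<^sub>B\<close>, where \<open>m = m\<^sub>i\<close> and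
  \<open>J\<close> is the ideal of the other fat points. Equivalently: a proper subspace \<open>S\<close> of \<open>R\<^sub>B\<close> that contains
  \<open>(I\<^sub>P\<^sup>m)\<^sub>B\<close> does not contain all of \<open>J\<close>. An element of \<open>J\<close> outside \<open>S\<close> is found among the products of \<open>B\<close> linear forms
  (\<open>separating_product\<close>), for which membership in \<open>J\<close> is combinatorial: each point \<open>P\<^sub>j\<close> must be a zero
  of at least \<open>m\<^sub>j\<close> of the factors.

  The factors are chosen one at a time. If \<open>l\<close> is chosen, the new subspace is \<open>S : l\<close>, consisting of the
  \<open>G\<close> with \<open>l G \<in> S\<close>; it contains \<open>I\<^sub>P\<^sup>m\<close> in degree \<open>B - 1\<close>, and even \<open>I\<^sub>P\<^sup>m\<^sup>-\<^sup>1\<close> when \<open>l\<close> vanishes at \<open>P\<close>. The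
  remaining points, counted with multiplicity, form a finite set \<open>E\<close> of labels, and the Segre bound
  says that \<open>|A| + (m - 1) \<le> B r(A)\<close> for all nonempty \<open>A \<subseteq> E\<close>, where \<open>r\<close> is the rank in \<open>V / \<langle>P\<rangle>\<close>. One has
  to find a set \<open>T \<subseteq> E\<close> of labels, to be killed by \<open>l\<close>, such that this inequality persists for \<open>E - T\<close> with
  \<open>B - 1\<close> for \<open>B\<close> (and \<open>m - 1\<close> for \<open>m\<close>, if \<open>m > 1\<close>), and such that some \<open>l\<close> that vanishes on \<open>T\<close> satisfies
  \<open>l R\<^sub>B\<^sub>-\<^sub>1 \<not>\<subseteq> S\<close>. There are two cases.

  If \<open>l R\<^sub>B\<^sub>-\<^sub>1 \<subseteq> S\<close> for every \<open>l\<close> that vanishes at \<open>P\<close>, then \<open>S\<close> contains \<open>(I\<^sub>P)\<^sub>B\<close>, one may take \<open>m = 1\<close>, and any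
  \<open>l\<close> with \<open>l(P) \<noteq> 0\<close> is good. This needs \<open>P \<notin> \<langle>T\<rangle>\<close>, which holds if \<open>T\<close> is independent modulo \<open>P\<close>.

  Otherwise the \<open>l \<in> P\<^sup>\<bottom>\<close> with \<open>l R\<^sub>B\<^sub>-\<^sub>1 \<subseteq> S\<close> form a proper subspace of \<open>P\<^sup>\<bottom>\<close>, hence they all vanish at some
  \<open>w \<notin> \<langle>P\<rangle>\<close>. It suffices that \<open>l\<close> vanishes on \<open>P\<close> and \<open>T\<close> but not at \<open>w\<close>, and such an \<open>l\<close> exists if \<open>T\<close> is
  independent modulo \<open>P\<close> and \<open>w\<close>.

  In both cases \<open>T\<close> is an independent set of a matroid that meets every \<open>A\<close> in prescribed numbers of
  elements. A theorem of Rado type for intersecting supermodular demands (\<open>independent_cover\<close>) gives the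
  criterion for its existence, and a short computation (\<open>peel_independent_set\<close>) deduces the criterion from
  the inequality above.
\<close>

section \<open>Independent sets that meet supermodular demands\<close>

text \<open>
  \<open>packing E p X v\<close> means that \<open>X\<close> is the union of a finite family of disjoint nonempty subsets of \<open>E\<close> whose
  \<open>p\<close>-values add up to \<open>v\<close>. The largest such \<open>v\<close> is what the demand \<open>p\<close> forces on \<open>X\<close>; working with all
  attainable values avoids taking maxima.
\<close>

inductive packing :: "'a set \<Rightarrow> ('a set \<Rightarrow> int) \<Rightarrow> 'a set \<Rightarrow> int \<Rightarrow> bool" for E p where
  packing_empty: "packing E p {} 0"
| packing_insert: "packing E p X v \<Longrightarrow> A \<noteq> {} \<Longrightarrow> A \<subseteq> E \<Longrightarrow> A \<inter> X = {} \<Longrightarrow> packing E p (X \<union> A) (v + p A)"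

lemma packing_subset: "packing E p X v \<Longrightarrow> X \<subseteq> E"
  by (induction rule: packing.induct) auto

lemma packing_disjoint_Un:
  assumes "packing E p Y w" "packing E p X v" "X \<inter> Y = {}"
  shows "packing E p (X \<union> Y) (v + w)"
  using assms(1,3)
proof (induction rule: packing.induct)
  case packing_empty
  then show ?case using assms(2) by simp
next
  case (packing_insert Y w A)
  then have "packing E p ((X \<union> Y) \<union> A) ((v + w) + p A)"
    by (intro packing.packing_insert) auto
  then show ?case by (simp add: Un_assoc add.assoc)
qed

locale intersecting_supermodular =
  fixes E :: "'a set" and p :: "'a set \<Rightarrow> int"
  assumes supermodular: "A \<subseteq> E \<Longrightarrow> B \<subseteq> E \<Longrightarrow> A \<inter> B \<noteq> {} \<Longrightarrow> p A + p B \<le> p (A \<union> B) + p (A \<inter> B)"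
begin

text \<open>
  A single set \<open>Q\<close> is absorbed into a packing of \<open>X\<close>: the blocks that meet \<open>Q\<close> are merged with it one after
  the other into \<open>R\<close>. They are disjoint, so the intersection split off at each merge is \<open>Q\<close> met with
  that block, and these pieces pack \<open>X \<inter> Q\<close>.
\<close>

lemma packing_uncross_block:
  assumes "packing E p X v" "Q \<noteq> {}" "Q \<subseteq> E"
  shows "\<exists>R v1 v2. Q \<subseteq> R \<and> R \<subseteq> X \<union> Q \<and> packing E p (X \<union> Q - R) v1 \<and> packing E p (X \<inter> Q) v2 \<and>
           v + p Q \<le> v1 + p R + v2"
  using assms(1)
proof (induction rule: packing.induct)
  case packing_empty
  have "packing E p ({} \<union> Q - Q) 0" "packing E p ({} \<inter> Q) 0"
    using packing.packing_empty[of E p] by auto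
  then show ?case by (intro exI[of _ Q] exI[of _ 0]) auto
next
  case (packing_insert X v A)
  then obtain R v1 v2 where R: "Q \<subseteq> R" "R \<subseteq> X \<union> Q" "packing E p (X \<union> Q - R) v1"
    "packing E p (X \<inter> Q) v2" "v + p Q \<le> v1 + p R + v2" by blast
  have RE: "R \<subseteq> E"
    using R(2) assms(3) packing_subset[OF packing_insert(1)] by blast
  show ?case
  proof (cases "A \<inter> Q = {}")
    case True
    have "packing E p ((X \<union> Q - R) \<union> A) (v1 + p A)"
      using packing_insert(2-4) R True by (intro packing.packing_insert) auto
    moreover have "(X \<union> Q - R) \<union> A = (X \<union> A) \<union> Q - R" using R(2) packing_insert(4) True by blast
    moreover have "(X \<union> A) \<inter> Q = X \<inter> Q" using True by blast
    ultimately show ?thesis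
      using R by (intro exI[of _ R] exI[of _ "v1 + p A"] exI[of _ v2]) auto
  next
    case False
    have RA: "R \<inter> A = Q \<inter> A" using R(1,2) packing_insert(4) by blast
    have "p R + p A \<le> p (R \<union> A) + p (Q \<inter> A)"
      using supermodular[OF RE packing_insert(3)] False RA by (simp add: Int_commute)
    moreover have "packing E p ((X \<inter> Q) \<union> (Q \<inter> A)) (v2 + p (Q \<inter> A))"
      using packing_insert(3,4) R False by (intro packing.packing_insert) auto
    moreover have "(X \<inter> Q) \<union> (Q \<inter> A) = (X \<union> A) \<inter> Q" by blast
    moreover have "(X \<union> A) \<union> Q - (R \<union> A) = X \<union> Q - R" using packing_insert(4) False R by blast
    ultimately show ?thesis
      using R by (intro exI[of _ "R \<union> A"] exI[of _ v1] exI[of _ "v2 + p (Q \<inter> A)"]) auto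
  qed
qed

text \<open>
  The upper truncation of an intersecting supermodular function is supermodular on all pairs of sets:
  the blocks of the second packing are absorbed one by one, and the pieces that they leave behind pack
  the intersection.
\<close>

lemma packing_uncross:
  assumes "packing E p Y w" "packing E p X v"
  shows "\<exists>v1 v2. packing E p (X \<union> Y) v1 \<and> packing E p (X \<inter> Y) v2 \<and> v + w \<le> v1 + v2"
  using assms(1)
proof (induction rule: packing.induct)
  case packing_empty
  show ?case using assms(2) packing.packing_empty[of E p] by (intro exI[of _ v] exI[of _ 0]) auto
next
  case (packing_insert Y w A)
  then obtain v1 v2 where v: "packing E p (X \<union> Y) v1" "packing E p (X \<inter> Y) v2" "v + w \<le> v1 + v2"
    by blast
  obtain R a1 a2 where R: "A \<subseteq> R" "R \<subseteq> X \<union> Y \<union> A" "packing E p (X \<union> Y \<union> A - R) a1"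
    "packing E p ((X \<union> Y) \<inter> A) a2" "v1 + p A \<le> a1 + p R + a2"
    using packing_uncross_block[OF v(1) packing_insert(2,3)] by blast
  have "packing E p ((X \<union> Y \<union> A - R) \<union> R) (a1 + p R)"
    using R packing_insert(2,3) packing_subset[OF v(1)] by (intro packing.packing_insert) auto
  moreover have "(X \<union> Y \<union> A - R) \<union> R = X \<union> (Y \<union> A)" using R by blast
  moreover have "packing E p ((X \<inter> Y) \<union> ((X \<union> Y) \<inter> A)) (v2 + a2)"
    using packing_insert(4) by (intro packing_disjoint_Un R v) blast
  moreover have "(X \<inter> Y) \<union> ((X \<union> Y) \<inter> A) = X \<inter> (Y \<union> A)" using packing_insert(4) by blast
  ultimately show ?case using v(3) R(5) by (intro exI[of _ "a1 + p R"] exI[of _ "v2 + a2"]) auto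
qed

end

locale rank_function =
  fixes E :: "'a set" and h :: "'a set \<Rightarrow> int"
  assumes finite_ground: "finite E"
    and rank_empty: "h {} = 0"
    and rank_mono: "X \<subseteq> Y \<Longrightarrow> Y \<subseteq> E \<Longrightarrow> h X \<le> h Y"
    and rank_insert: "X \<subseteq> E \<Longrightarrow> e \<in> E \<Longrightarrow> h (insert e X) \<le> h X + 1"
    and rank_submodular: "X \<subseteq> E \<Longrightarrow> Y \<subseteq> E \<Longrightarrow> h (X \<union> Y) + h (X \<inter> Y) \<le> h X + h Y"
begin

lemma rank_Un_le: "X \<subseteq> E \<Longrightarrow> Y \<subseteq> E \<Longrightarrow> h (X \<union> Y) \<le> h X + int (card Y)"
proof -
  assume X: "X \<subseteq> E" and Y: "Y \<subseteq> E"
  have "finite Y" using Y finite_ground finite_subset by blast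
  then show ?thesis using Y
  proof (induction rule: finite_induct)
    case empty
    then show ?case by simp
  next
    case (insert e Y)
    then show ?case using rank_insert[of "X \<union> Y" e] X by auto
  qed
qed

lemma rank_le_card: "X \<subseteq> E \<Longrightarrow> h X \<le> int (card X)"
  using rank_Un_le[of "{}" X] rank_empty by simp

text \<open>
  By submodularity a coloop of \<open>D\<close> remains one when other coloops are removed, so each contributes \<open>1\<close>.
\<close>

lemma rank_Un_coloops:
  assumes "D \<subseteq> E" "C \<subseteq> D" and coloop: "\<And>e. e \<in> C \<Longrightarrow> h (D - {e}) = h D - 1"
  shows "h D = h (D - C) + int (card C)"
proof -
  have "finite C" using assms(1,2) finite_ground by (meson finite_subset)
  then show ?thesis using assms(2) coloop
  proof (induction rule: finite_induct)
    case empty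
    then show ?case by simp
  next
    case (insert e C)
    have eC: "e \<in> D" "C \<subseteq> D" "e \<notin> C" using insert(2,4) by blast+
    have eqs: "(D - C) \<union> (D - {e}) = D" "(D - C) \<inter> (D - {e}) = D - insert e C"
      "insert e (D - insert e C) = D - C" using eC by blast+
    have "h D = h (D - C) + int (card C)" by (rule insert(3)[OF eC(2)]) (rule insert(5), blast)
    moreover have "h D + h (D - insert e C) \<le> h (D - C) + h (D - {e})"
      using rank_submodular[of "D - C" "D - {e}"] assms(1) unfolding eqs by blast
    moreover have "h (D - {e}) = h D - 1" by (rule insert(5)) blast
    moreover have "h (D - C) \<le> h (D - insert e C) + 1"
      using rank_insert[of "D - insert e C" e] assms(1) eC(1) unfolding eqs by blast
    moreover have "int (card (insert e C)) = int (card C) + 1" using insert(1,2) by simp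
    ultimately show "h D = h (D - insert e C) + int (card (insert e C))" by linarith
  qed
qed

lemma coloop_antimono:
  assumes "X \<subseteq> E" "D \<subseteq> X" "e \<in> D" "h (X - {e}) < h X"
  shows "h (D - {e}) = h D - 1"
proof -
  have "h (D \<union> (X - {e})) + h (D \<inter> (X - {e})) \<le> h D + h (X - {e})"
    using assms by (intro rank_submodular) auto
  moreover have "D \<union> (X - {e}) = X" "D \<inter> (X - {e}) = D - {e}" using assms by auto
  moreover have "h (insert e (D - {e})) \<le> h (D - {e}) + 1"
    using assms by (intro rank_insert) auto
  moreover have "insert e (D - {e}) = D" using assms by auto
  ultimately show ?thesis using assms by simp
qed

end

text \<open>
  A theorem of Rado type: the demands \<open>p A\<close> can be met by an independent set as soon as no packing demands
  more than the rank of its union. The elements of \<open>E\<close> are discarded as long as the hypothesis survives.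
  In the remaining set \<open>T\<close> every element is a coloop of some tight set, that is, of a set for which the
  demand equals the rank. Tight sets are closed under union and intersection and the rank is modular on
  them, so a maximal independent tight set can be enlarged by a minimal tight set that is not contained in
  it, whose new elements are all coloops. Hence \<open>T\<close> itself is independent, and then \<open>|A \<inter> T|\<close> is at least the
  rank of \<open>A \<inter> T\<close>, which is at least the demand.
\<close>

theorem (in rank_function) independent_cover:
  assumes "intersecting_supermodular E p"
    and packing_le: "\<And>X v. packing E p X v \<Longrightarrow> v \<le> h X"
  shows "\<exists>T\<subseteq>E. h T = int (card T) \<and> (\<forall>A\<subseteq>E. A \<noteq> {} \<longrightarrow> p A \<le> int (card (A \<inter> T)))"
proof -
  interpret p: intersecting_supermodular E p by fact
  define good where "good T \<longleftrightarrow> T \<subseteq> E \<and> (\<forall>X v. packing E p X v \<longrightarrow> v \<le> h (X \<inter> T))" for T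
  have "good E" unfolding good_def using packing_le packing_subset by (metis Int_absorb2 order_refl)
  then obtain T where T: "good T" and T_min: "\<And>T'. good T' \<Longrightarrow> card T \<le> card T'"
    using ex_has_least_nat[of good E card] by blast
  have TE: "T \<subseteq> E" using T good_def by blast
  have fT: "finite T" using TE finite_ground finite_subset by blast
  have le: "v \<le> h (X \<inter> T)" if "packing E p X v" for X v using T that good_def by blast
  define tight where "tight X \<longleftrightarrow> (\<exists>v. packing E p X v \<and> v = h (X \<inter> T))" for X
  have tight_uncross: "tight (X \<union> Y) \<and> tight (X \<inter> Y) \<and>
      h ((X \<union> Y) \<inter> T) + h (X \<inter> Y \<inter> T) = h (X \<inter> T) + h (Y \<inter> T)" if XY: "tight X" "tight Y" for X Y
  proof -
    obtain v1 v2 where v: "packing E p (X \<union> Y) v1" "packing E p (X \<inter> Y) v2"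
      "h (X \<inter> T) + h (Y \<inter> T) \<le> v1 + v2"
      using p.packing_uncross XY unfolding tight_def by blast
    have "h ((X \<inter> T) \<union> (Y \<inter> T)) + h ((X \<inter> T) \<inter> (Y \<inter> T)) \<le> h (X \<inter> T) + h (Y \<inter> T)"
      using TE by (intro rank_submodular) auto
    moreover have "(X \<inter> T) \<union> (Y \<inter> T) = (X \<union> Y) \<inter> T" "(X \<inter> T) \<inter> (Y \<inter> T) = X \<inter> Y \<inter> T" by auto
    ultimately show ?thesis using v le[OF v(1)] le[OF v(2)] unfolding tight_def
      by (smt (verit))
  qed
  \<comment> \<open>By minimality of \<open>T\<close>, discarding \<open>e\<close> violates some packing, whose union is therefore tight.\<close>
  have ex_tight: "\<exists>X. tight X \<and> e \<in> X \<and> h (X \<inter> T - {e}) < h (X \<inter> T)" if e: "e \<in> T" for e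
  proof -
    have "card (T - {e}) < card T" using fT e by (rule card_Diff1_less)
    then have "\<not> good (T - {e})" using T_min by fastforce
    then obtain X v where X: "packing E p X v" "v > h (X \<inter> (T - {e}))"
      unfolding good_def using TE by (meson Diff_subset not_le order_trans)
    have eq: "X \<inter> (T - {e}) = X \<inter> T - {e}" by auto
    have eX: "e \<in> X" using X le[OF X(1)] eq by (cases "e \<in> X") auto
    have "h (insert e (X \<inter> T - {e})) \<le> h (X \<inter> T - {e}) + 1" using e TE by (intro rank_insert) auto
    moreover have "insert e (X \<inter> T - {e}) = X \<inter> T" using e eX by auto
    ultimately have "v = h (X \<inter> T)" using X le[OF X(1)] eq by simp
    then show ?thesis using X eX eq unfolding tight_def by force
  qed
  define indep where "indep Y \<longleftrightarrow> tight Y \<and> h (Y \<inter> T) = int (card (Y \<inter> T))" for Y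
  have "indep {}" unfolding indep_def tight_def using packing_empty[of E p] rank_empty by auto
  moreover have "card (Y \<inter> T) \<le> card T" for Y using fT by (simp add: card_mono)
  ultimately obtain Y where Y: "indep Y" and Y_max: "\<And>Y'. indep Y' \<Longrightarrow> card (Y' \<inter> T) \<le> card (Y \<inter> T)"
    using ex_has_greatest_nat[of indep "{}" "\<lambda>Y. card (Y \<inter> T)" "Suc (card T)"] by (auto simp: less_Suc_eq_le)
  have "T \<subseteq> Y"
  proof (rule ccontr)
    assume "\<not> T \<subseteq> Y"
    then obtain e0 where e0: "e0 \<in> T" "e0 \<notin> Y" by blast
    define Q where "Q X \<longleftrightarrow> tight X \<and> \<not> X \<inter> T \<subseteq> Y" for X
    have "\<exists>X. Q X" using ex_tight[OF e0(1)] e0 unfolding Q_def by blast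
    then obtain D where D: "Q D" and D_min: "\<And>D'. Q D' \<Longrightarrow> card (D \<inter> T) \<le> card (D' \<inter> T)"
      using ex_has_least_nat[of Q _ "\<lambda>X. card (X \<inter> T)"] by blast
    \<comment> \<open>Otherwise \<open>D\<close> could be cut down with a tight set that has \<open>e\<close> as a coloop.\<close>
    have coloop: "h (D \<inter> T - {e}) = h (D \<inter> T) - 1" if e: "e \<in> D \<inter> T - Y" for e
    proof -
      obtain X where X: "tight X" "e \<in> X" "h (X \<inter> T - {e}) < h (X \<inter> T)" using ex_tight e by blast
      have "Q (D \<inter> X)" using tight_uncross D X e unfolding Q_def by blast
      then have "card (D \<inter> T) \<le> card (D \<inter> X \<inter> T)" using D_min by blast
      then have "D \<inter> X \<inter> T = D \<inter> T" using fT by (intro card_seteq) auto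
      then show ?thesis using X e TE by (intro coloop_antimono[of "X \<inter> T"]) auto
    qed
    have "h (D \<inter> T) = h (D \<inter> T - (D \<inter> T - Y)) + int (card (D \<inter> T - Y))"
      using TE coloop by (intro rank_Un_coloops) auto
    moreover have "D \<inter> T - (D \<inter> T - Y) = Y \<inter> D \<inter> T" by auto
    moreover have "h ((Y \<union> D) \<inter> T) + h (Y \<inter> D \<inter> T) = h (Y \<inter> T) + h (D \<inter> T)" "tight (Y \<union> D)"
      using tight_uncross[of Y D] Y D unfolding indep_def Q_def by auto
    moreover have "card ((Y \<union> D) \<inter> T) = card (Y \<inter> T) + card (D \<inter> T - Y)"
    proof -
      have "(Y \<union> D) \<inter> T = (Y \<inter> T) \<union> (D \<inter> T - Y)" by auto
      then show ?thesis using fT by (simp add: card_Un_disjoint Int_Diff Diff_eq Int_ac)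
    qed
    ultimately have "indep (Y \<union> D)" using Y unfolding indep_def by simp
    then have "card ((Y \<union> D) \<inter> T) \<le> card (Y \<inter> T)" by (rule Y_max)
    moreover have "D \<inter> T - Y \<noteq> {}" using D unfolding Q_def by blast
    then have "card (D \<inter> T - Y) > 0" using fT by (simp add: card_gt_0_iff)
    ultimately show False using \<open>card ((Y \<union> D) \<inter> T) = _\<close> by simp
  qed
  then have "Y \<inter> T = T" by auto
  then have "h T = int (card T)" using Y unfolding indep_def by simp
  moreover have "p A \<le> int (card (A \<inter> T))" if A: "A \<subseteq> E" "A \<noteq> {}" for A
  proof -
    have "packing E p ({} \<union> A) (0 + p A)" using A by (intro packing.intros) auto
    then have "p A \<le> h (A \<inter> T)" using le by fastforce
    also have "\<dots> \<le> int (card (A \<inter> T))" using A by (intro rank_le_card) auto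
    finally show ?thesis .
  qed
  ultimately show ?thesis using TE by blast
qed

text \<open>
  The packing criterion in \<open>peel_independent_set\<close>, for a packing with \<open>t\<close> blocks, union of size \<open>c\<close> and
  rank \<open>r\<close>, and blocks of total rank \<open>R\<close>. Adding the density inequality over the blocks gives the
  first hypothesis, which is the better one if the blocks have small total rank; the second one is density
  of the union. The maximum is truncated subtraction.
\<close>

lemma peel_arith:
  fixes c R t r h i B :: int
  assumes "c + t * i \<le> (B + 1) * R" "c + i \<le> (B + 1) * r" "1 \<le> t" "0 \<le> B"
    and "i = 0 \<and> r = h \<or> 1 \<le> i \<and> i \<le> B \<and> r \<le> h + 1"
  shows "c - B * R + t * max 0 (i - 1) \<le> h"
  using assms(5)
proof
  assume i: "i = 0 \<and> r = h"
  show ?thesis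
  proof (cases "R \<le> h")
    case True
    have "c \<le> B * R + R" using assms(1) i by (simp add: distrib_right)
    then show ?thesis using True i by simp
  next
    case False
    then have "B * h \<le> B * R" using \<open>0 \<le> B\<close> by (intro mult_left_mono) auto
    moreover have "c \<le> B * h + h" using assms(2) i by (simp add: distrib_right)
    ultimately show ?thesis using i by simp
  qed
next
  assume i: "1 \<le> i \<and> i \<le> B \<and> r \<le> h + 1"
  have m: "t * max 0 (i - 1) = t * i - t" using i by (simp add: right_diff_distrib)
  show ?thesis
  proof (cases "R - t \<le> h")
    case True
    have "c + t * i \<le> B * R + R" using assms(1) by (simp add: distrib_right)
    then show ?thesis using True m by linarith
  next
    case False
    then have "B * (h + 1) \<le> B * (R - t)" using \<open>0 \<le> B\<close> by (intro mult_left_mono) auto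
    then have 1: "B * h + B \<le> B * R - B * t" by (simp add: distrib_left right_diff_distrib)
    have "1 * (B - i) \<le> t * (B - i)" using i assms(3) by (intro mult_right_mono) auto
    then have 2: "B - i \<le> t * B - t * i" by (simp add: right_diff_distrib)
    have "(B + 1) * r \<le> (B + 1) * (h + 1)" using i assms(4) by (intro mult_left_mono) auto
    then have 3: "c + i \<le> B * h + B + h + 1" using assms(2) by (simp add: distrib_left distrib_right)
    have 4: "t * B = B * t" by simp
    show ?thesis using 1 2 3 4 m i assms(3) by linarith
  qed
qed

text \<open>
  Let \<open>r\<close> and \<open>h\<close> be rank functions such that \<open>h\<close> is \<open>r\<close>, or, if \<open>i > 0\<close>, differs from it by at most one,
  as for the contraction of one more element. If \<open>E\<close> is dense at most \<open>B + 1\<close>, with \<open>i\<close> to spare on each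
  nonempty set, then removing a suitable set independent for \<open>h\<close> makes it dense at most \<open>B\<close>, with \<open>i - 1\<close> to
  spare. What \<open>T\<close> must take from \<open>A\<close> is the excess of \<open>A\<close> over the new density. As the term \<open>i - 1\<close> is counted
  once per block, this demand is supermodular only on intersecting pairs.
\<close>

theorem peel_independent_set:
  fixes i B :: nat
  assumes "rank_function E r" "rank_function E h"
    and hr: "\<And>A. A \<subseteq> E \<Longrightarrow> h A \<le> r A" and rh: "\<And>A. A \<subseteq> E \<Longrightarrow> r A \<le> h A + (if i = 0 then 0 else 1)"
    and dense: "\<And>A. A \<subseteq> E \<Longrightarrow> A \<noteq> {} \<Longrightarrow> int (card A) + int i \<le> (int B + 1) * r A"
  shows "\<exists>T\<subseteq>E. h T = int (card T) \<and>
           (\<forall>A\<subseteq>E - T. A \<noteq> {} \<longrightarrow> int (card A) + int (i - 1) \<le> int B * r A)"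
proof -
  interpret r: rank_function E r by fact
  interpret h: rank_function E h by fact
  define p where "p A = int (card A) - int B * r A + int (i - 1)" for A
  have finite: "finite A" if "A \<subseteq> E" for A using that r.finite_ground finite_subset by blast
  have p: "intersecting_supermodular E p"
  proof
    fix A C assume AC: "A \<subseteq> E" "C \<subseteq> E"
    have "card A + card C = card (A \<union> C) + card (A \<inter> C)"
      using AC finite by (intro card_Un_Int) auto
    moreover have "int B * (r (A \<union> C) + r (A \<inter> C)) \<le> int B * (r A + r C)"
      using r.rank_submodular[OF AC] by (intro mult_left_mono) auto
    ultimately show "p A + p C \<le> p (A \<union> C) + p (A \<inter> C)" unfolding p_def by (simp add: algebra_simps)
  qed
  have r1: "1 \<le> r A" if A: "A \<subseteq> E" "A \<noteq> {}" for A
  proof -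
    have "card A \<ge> 1" using A finite by (simp add: Suc_le_eq card_gt_0_iff)
    then have "0 < (int B + 1) * r A" using dense[OF A] by linarith
    then show ?thesis by (simp add: zero_less_mult_iff)
  qed
  have iB: "i \<le> B" if "E \<noteq> {}"
  proof -
    obtain e where e: "e \<in> E" using \<open>E \<noteq> {}\<close> by blast
    have "r {e} \<le> 1" using r.rank_le_card[of "{e}"] e by simp
    then have "(int B + 1) * r {e} \<le> (int B + 1) * 1" by (intro mult_left_mono) auto
    also have "\<dots> = 1 + int B" by simp
    finally have "(int B + 1) * r {e} \<le> 1 + int B" .
    moreover have "1 + int i \<le> (int B + 1) * r {e}" using dense[of "{e}"] e by (simp del: of_nat_Suc)
    ultimately have "1 + int i \<le> 1 + int B" by (rule order_trans[rotated])
    then show ?thesis by simp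
  qed
  have pack: "\<exists>R t. v = int (card X) - int B * R + t * int (i - 1) \<and> int (card X) + t * int i \<le> (int B + 1) * R
                 \<and> 0 \<le> t \<and> t \<le> R \<and> (X \<noteq> {} \<longrightarrow> 1 \<le> t)" if "packing E p X v" for X v
    using that
  proof (induction rule: packing.induct)
    case packing_empty
    show ?case by (rule exI[of _ 0], rule exI[of _ 0]) simp
  next
    case (packing_insert X v A)
    then obtain R t where Rt: "v = int (card X) - int B * R + t * int (i - 1)"
      "int (card X) + t * int i \<le> (int B + 1) * R" "0 \<le> t" "t \<le> R" by blast
    have "card (X \<union> A) = card X + card A"
      using finite[OF packing_insert(3)] finite[OF packing_subset[OF packing_insert(1)]] packing_insert(4)
      by (subst card_Un_disjoint) auto
    then have "v + p A = int (card (X \<union> A)) - int B * (R + r A) + (t + 1) * int (i - 1)"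
      unfolding p_def Rt(1) distrib_left distrib_right by linarith
    moreover have "int (card (X \<union> A)) + (t + 1) * int i \<le> (int B + 1) * (R + r A)"
      using \<open>card (X \<union> A) = _\<close> Rt(2) dense[OF packing_insert(3,2)]
      unfolding distrib_left distrib_right by linarith
    moreover have "0 \<le> t + 1" "t + 1 \<le> R + r A" "1 \<le> t + 1"
      using Rt(3,4) r1[OF packing_insert(3,2)] by linarith+
    ultimately show ?case by blast
  qed
  have "v \<le> h X" if P: "packing E p X v" for X v
  proof (cases "X = {}")
    case True
    have "packing E p X v \<Longrightarrow> X = {} \<Longrightarrow> v = 0" by (erule packing.cases) auto
    then show ?thesis using True P h.rank_empty by simp
  next
    case False
    have XE: "X \<subseteq> E" by (rule packing_subset[OF P])
    obtain R t where Rt: "v = int (card X) - int B * R + t * int (i - 1)"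
      "int (card X) + t * int i \<le> (int B + 1) * R" "1 \<le> t" using pack[OF P] False by blast
    have "int (card X) + int i \<le> (int B + 1) * r X" using dense[OF XE False] .
    moreover have "int i = 0 \<and> r X = h X \<or> 1 \<le> int i \<and> int i \<le> int B \<and> r X \<le> h X + 1"
      using hr[OF XE] rh[OF XE] iB XE \<open>X \<noteq> {}\<close> by (cases "i = 0") auto
    ultimately have "int (card X) - int B * R + t * max 0 (int i - 1) \<le> h X"
      using Rt(2,3) by (intro peel_arith) auto
    moreover have "int (i - 1) = max 0 (int i - 1)" by auto
    ultimately show ?thesis unfolding Rt(1) by simp
  qed
  then have "\<exists>T\<subseteq>E. h T = int (card T) \<and> (\<forall>A\<subseteq>E. A \<noteq> {} \<longrightarrow> p A \<le> int (card (A \<inter> T)))"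
    by (rule h.independent_cover[OF p])
  then obtain T where T: "T \<subseteq> E" "h T = int (card T)"
    and pT: "\<forall>A\<subseteq>E. A \<noteq> {} \<longrightarrow> p A \<le> int (card (A \<inter> T))" by (elim exE conjE)
  have "int (card A) + int (i - 1) \<le> int B * r A" if A: "A \<subseteq> E - T" "A \<noteq> {}" for A
  proof -
    have "A \<inter> T = {}" "A \<subseteq> E" using A by auto
    moreover have "p A \<le> int (card (A \<inter> T))" using pT \<open>A \<subseteq> E\<close> A(2) by (elim allE impE)
    ultimately have "p A \<le> 0" by (simp only: card.empty of_nat_0)
    then show ?thesis unfolding p_def by linarith
  qed
  then show ?thesis using T by (intro exI[of _ T]) simp
qed

section \<open>Linear forms and ranks in quotients of a vector space\<close>

definition dotp :: "'k::field ^ 'v::finite \<Rightarrow> 'k ^ 'v \<Rightarrow> 'k" where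
  "dotp c x = (\<Sum>v\<in>UNIV. c $ v * x $ v)"

lemma dotp_add_left: "dotp (a + b) x = dotp a x + dotp b x"
  by (simp add: dotp_def distrib_right sum.distrib)

lemma dotp_scale_left: "dotp (r *s a) x = r * dotp a x"
  by (simp add: dotp_def sum_distrib_left mult.assoc)

lemma dotp_scale_right: "dotp a (r *s x) = r * dotp a x"
  by (simp add: dotp_def sum_distrib_left mult_ac)

lemma dotp_zero [simp]: "dotp 0 x = 0" "dotp x 0 = 0"
  by (simp_all add: dotp_def)

lemma dotp_axis: "dotp (axis v 1) x = x $ v"
  by (simp add: dotp_def axis_def if_distrib[of "\<lambda>a. a * _"] cong: if_cong)

lemma dotp_sym: "dotp x y = dotp y x"
  by (simp add: dotp_def mult.commute)

text \<open>
  A vector outside the span of \<open>S\<close> is separated from \<open>S\<close> by a linear form: extend a linear map that vanishes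
  on a basis of the span, and read off one coordinate.
\<close>

lemma separating_form:
  fixes S :: "('k::field ^ 'v::finite) set"
  assumes "u \<notin> vec.span S"
  shows "\<exists>c. (\<forall>x\<in>S. dotp c x = 0) \<and> dotp c u \<noteq> 0"
proof -
  obtain B where B: "B \<subseteq> S" "vec.independent B" "vec.span B = vec.span S"
    using vec.maximal_independent_subset[of S] vec.span_eq vec.span_superset by (metis subset_trans)
  have u: "u \<notin> vec.span B" using assms B(3) by simp
  then have ins: "vec.independent (insert u B)" using B(2) by (rule vec.independent_insertI)
  obtain v0 :: 'v where True by blast
  obtain f where f: "Vector_Spaces.linear (*s) (*s) f" "\<forall>x\<in>insert u B. f x = (if x = u then axis v0 1 else 0)"
    using vec.linear_independent_extend[OF ins, of "\<lambda>x. if x = u then axis v0 1 else 0"] by blast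
  have "f x = 0" if "x \<in> vec.span B" for x
    using that
  proof (induction rule: vec.span_induct_alt)
    case base
    show ?case by (rule vec.linear_0[OF f(1)])
  next
    case (step r x y)
    have "x \<noteq> u" using step(1) u vec.span_base by blast
    then have "f x = 0" using f(2) step(1) by auto
    then show ?case using step(2) by (simp add: vec.linear_add[OF f(1)] vec.linear_scale[OF f(1)])
  qed
  moreover have f_dotp: "f x $ v0 = dotp (row v0 (matrix f)) x" for x
  proof -
    have "f x = matrix f *v x" using matrix_works[OF f(1), of x] by simp
    then show ?thesis by (simp add: matrix_vector_mult_def dotp_def row_def)
  qed
  ultimately have "dotp (row v0 (matrix f)) x = 0" if "x \<in> S" for x
    using vec.span_base[OF that] B(3) by (metis zero_index)
  moreover have "f u = axis v0 1" using f(2) by simp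
  then have "dotp (row v0 (matrix f)) u \<noteq> 0"
    using f_dotp[of u] by (simp add: axis_def)
  ultimately show ?thesis by blast
qed

text \<open>
  The rank of the images of the vectors \<open>q e\<close>, for \<open>e\<close> in \<open>A\<close>, in the quotient by the span of \<open>C\<close>. The ground
  set consists of labels so that a vector can occur repeatedly.
\<close>

definition contraction_rank :: "('k::field ^ 'v::finite) set \<Rightarrow> ('e \<Rightarrow> 'k ^ 'v) \<Rightarrow> 'e set \<Rightarrow> int" where
  "contraction_rank C q A = int (vec.dim (C \<union> q ` A)) - int (vec.dim C)"

lemma dim_Un_submodular:
  "vec.dim (X \<union> Y) + vec.dim (X \<inter> Y) \<le> vec.dim X + vec.dim (Y :: ('k::field ^ 'v::finite) set)"
proof -
  let ?S = "vec.span X" and ?T = "vec.span Y"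
  have "vec.dim {x + y |x y. x \<in> ?S \<and> y \<in> ?T} + vec.dim (?S \<inter> ?T) = vec.dim ?S + vec.dim ?T"
    by (intro vec.dim_sums_Int) auto
  moreover have "X \<union> Y \<subseteq> {x + y |x y. x \<in> ?S \<and> y \<in> ?T}"
  proof
    fix z assume "z \<in> X \<union> Y"
    then consider "z \<in> ?S" | "z \<in> ?T" using vec.span_base by blast
    then show "z \<in> {x + y |x y. x \<in> ?S \<and> y \<in> ?T}"
    proof cases
      case 1
      then have "z = z + 0 \<and> z \<in> ?S \<and> 0 \<in> ?T" using vec.span_zero[of Y] by simp
      then show ?thesis by blast
    next
      case 2
      then have "z = 0 + z \<and> 0 \<in> ?S \<and> z \<in> ?T" using vec.span_zero[of X] by simp
      then show ?thesis by blast
    qed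
  qed
  then have "vec.dim (X \<union> Y) \<le> vec.dim {x + y |x y. x \<in> ?S \<and> y \<in> ?T}" by (rule vec.dim_subset)
  moreover have "vec.dim (X \<inter> Y) \<le> vec.dim (?S \<inter> ?T)"
    using vec.span_base by (intro vec.dim_subset) blast
  ultimately show ?thesis by (simp add: vec.dim_span)
qed

lemma rank_function_contraction:
  assumes "finite E"
  shows "rank_function E (contraction_rank C q)"
proof
  show "contraction_rank C q {} = 0" by (simp add: contraction_rank_def)
  fix X Y
  show "contraction_rank C q X \<le> contraction_rank C q Y" if "X \<subseteq> Y"
    using that vec.dim_subset[of "C \<union> q ` X" "C \<union> q ` Y"] by (auto simp: contraction_rank_def)
  show "contraction_rank C q (insert e X) \<le> contraction_rank C q X + 1" for e
    by (simp add: contraction_rank_def vec.dim_insert)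
  have "(C \<union> q ` X) \<union> (C \<union> q ` Y) = C \<union> q ` (X \<union> Y)" by blast
  moreover have "vec.dim (C \<union> q ` (X \<inter> Y)) \<le> vec.dim ((C \<union> q ` X) \<inter> (C \<union> q ` Y))"
    by (intro vec.dim_subset) blast
  ultimately show "contraction_rank C q (X \<union> Y) + contraction_rank C q (X \<inter> Y)
      \<le> contraction_rank C q X + contraction_rank C q Y"
    using dim_Un_submodular[of "C \<union> q ` X" "C \<union> q ` Y"] by (simp add: contraction_rank_def)
qed (use assms in auto)

text \<open>
  The form in which independence modulo \<open>C\<close> is used: labels of an independent set carry different
  vectors, and an element of \<open>C\<close> can be separated from these vectors and the rest of \<open>C\<close>.
\<close>

lemma contraction_independent:
  assumes "finite T" "contraction_rank C q T = int (card T)" "vec.independent C"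
  shows "inj_on q T" "\<And>u. u \<in> C \<Longrightarrow> u \<notin> vec.span ((C - {u}) \<union> q ` T)"
proof -
  have fC: "finite C" using assms(3) by (rule vec.finiteI_independent)
  have d: "vec.dim (C \<union> q ` T) = card C + card T"
    using assms(2) by (simp add: contraction_rank_def vec.dim_eq_card_independent[OF assms(3)])
  have "vec.dim (C \<union> q ` T) \<le> card (C \<union> q ` T)" using fC assms(1) by (intro vec.dim_le_card') auto
  moreover have "card (C \<union> q ` T) \<le> card C + card (q ` T)" by (rule card_Un_le)
  ultimately have "card T \<le> card (q ` T)" using d by linarith
  then show "inj_on q T" using assms(1) by (intro eq_card_imp_inj_on) (auto intro: antisym card_image_le)
  fix u assume u: "u \<in> C"
  show "u \<notin> vec.span ((C - {u}) \<union> q ` T)"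
  proof
    assume "u \<in> vec.span ((C - {u}) \<union> q ` T)"
    then have "vec.dim (insert u ((C - {u}) \<union> q ` T)) = vec.dim ((C - {u}) \<union> q ` T)"
      by (simp add: vec.dim_insert)
    also have "\<dots> \<le> card ((C - {u}) \<union> q ` T)" using fC assms(1) by (intro vec.dim_le_card') auto
    also have "\<dots> \<le> card (C - {u}) + card T"
      using card_Un_le[of "C - {u}" "q ` T"] card_image_le[OF assms(1), of q] by linarith
    also have "\<dots> < card C + card T" using u fC card_Diff1_less[of C u] by simp
    finally show False using d u by (simp add: insert_absorb insert_Diff_if flip: Un_insert_left)
  qed
qed

section \<open>Polynomials, forms and evaluation\<close>

abbreviation single where "single \<equiv> Poly_Mapping.single"
abbreviation lookup where "lookup \<equiv> Poly_Mapping.lookup"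
abbreviation keys where "keys \<equiv> Poly_Mapping.keys"

text \<open>
  Scalars act through the constant polynomials, as they do in the definition of the Hilbert function.
\<close>

definition scal :: "'k::field \<Rightarrow> ('v::finite, 'k) mpoly \<Rightarrow> ('v, 'k) mpoly" where
  "scal c f = single 0 c * f"

interpretation MP: vector_space scal
  by unfold_locales
    (simp_all add: scal_def single_add algebra_simps mult_single flip: mult.assoc)

lemma lookup_scal: "lookup (scal c f) t = c * lookup f t"
  unfolding scal_def mult_map_scale_conv_mult[symmetric] by (simp add: Poly_Mapping.map.rep_eq when_def)

lemma scal_mult_left: "scal c f * g = scal c (f * g)" and scal_mult_right: "f * scal c g = scal c (f * g)"
  by (simp_all add: scal_def mult_ac)

lemma scal_single: "scal c (single t a) = single t (c * a)"
  by (simp add: scal_def mult_single)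

lemma sum_monomials:
  assumes "finite A" "keys f \<subseteq> A"
  shows "f = (\<Sum>t\<in>A. scal (lookup f t) (single t 1))"
proof (rule poly_mapping_eqI)
  fix u
  have "lookup (\<Sum>t\<in>A. scal (lookup f t) (single t 1)) u = (\<Sum>t\<in>A. if t = u then lookup f t else 0)"
    by (simp add: lookup_sum scal_single lookup_single when_def)
  also have "\<dots> = lookup f u"
    using assms by (auto simp: in_keys_iff)
  finally show "lookup f u = lookup (\<Sum>t\<in>A. scal (lookup f t) (single t 1)) u" by simp
qed

definition mdeg :: "('v::finite \<Rightarrow>\<^sub>0 nat) \<Rightarrow> nat" where
  "mdeg t = (\<Sum>v\<in>UNIV. lookup t v)"

lemma mdeg_add: "mdeg (s + t) = mdeg s + mdeg t"
  by (simp add: mdeg_def lookup_add sum.distrib)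

lemma mdeg_zero [simp]: "mdeg 0 = 0"
  by (simp add: mdeg_def)

lemma mdeg_single [simp]: "mdeg (single v a) = a"
  by (simp add: mdeg_def lookup_single when_def)

lemma homogeneous_part_iff: "f \<in> homogeneous_part d \<longleftrightarrow> (\<forall>t. lookup f t \<noteq> 0 \<longrightarrow> mdeg t = d)"
  by (auto simp: homogeneous_part_def mdeg_def in_keys_iff)

lemma subspace_homogeneous_part: "MP.subspace (homogeneous_part d)"
  by (auto simp: MP.subspace_def homogeneous_part_iff lookup_add lookup_scal) (metis add_0)

lemma homogeneous_part_mult:
  assumes "f \<in> homogeneous_part a" "g \<in> homogeneous_part b"
  shows "f * g \<in> homogeneous_part (a + b)"
  using assms keys_mult[of f g] unfolding homogeneous_part_def mdeg_def[symmetric]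
  by (auto simp: mdeg_add)

lemma homogeneous_part_single [simp]: "single t a \<in> homogeneous_part (mdeg t)"
  by (auto simp: homogeneous_part_iff lookup_single when_def split: if_splits)

lemma one_homogeneous_part [simp]: "1 \<in> homogeneous_part 0"
  by (auto simp: homogeneous_part_iff lookup_one when_def split: if_splits)

lemma homogeneous_part_power: "f \<in> homogeneous_part a \<Longrightarrow> f ^ n \<in> homogeneous_part (n * a)"
  by (induction n) (auto intro: homogeneous_part_mult)

lemma homogeneous_part_prod:
  "finite A \<Longrightarrow> (\<And>x. x \<in> A \<Longrightarrow> f x \<in> homogeneous_part (d x)) \<Longrightarrow> prod f A \<in> homogeneous_part (sum d A)"
  by (induction A rule: finite_induct) (auto intro: homogeneous_part_mult)

lemma mpoly_eval_superset:
  assumes "finite A" "keys f \<subseteq> A"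
  shows "mpoly_eval f p = (\<Sum>t\<in>A. lookup f t * (\<Prod>v\<in>UNIV. (p $ v) ^ lookup t v))"
  unfolding mpoly_eval_def using assms by (intro sum.mono_neutral_left) (auto simp: in_keys_iff)

lemma mpoly_eval_add: "mpoly_eval (f + g) p = mpoly_eval f p + mpoly_eval g p"
proof -
  have *: "keys (f + g) \<subseteq> keys f \<union> keys g" "keys f \<subseteq> keys f \<union> keys g" "keys g \<subseteq> keys f \<union> keys g"
    "finite (keys f \<union> keys g)"
    using keys_add[of f g] by auto
  show ?thesis
    unfolding mpoly_eval_superset[OF *(4,1)] mpoly_eval_superset[OF *(4,2)] mpoly_eval_superset[OF *(4,3)]
    by (simp add: lookup_add distrib_right sum.distrib)
qed

lemma mpoly_eval_scal: "mpoly_eval (scal c f) p = c * mpoly_eval f p"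
proof -
  have "keys (scal c f) \<subseteq> keys f" by (auto simp: in_keys_iff lookup_scal)
  then have "mpoly_eval (scal c f) p = (\<Sum>t\<in>keys f. lookup (scal c f) t * (\<Prod>v\<in>UNIV. (p $ v) ^ lookup t v))"
    by (intro mpoly_eval_superset) auto
  then show ?thesis by (simp add: lookup_scal sum_distrib_left mult.assoc mpoly_eval_def)
qed

lemma mpoly_eval_zero [simp]: "mpoly_eval 0 p = 0"
  by (simp add: mpoly_eval_def)

lemma mpoly_eval_sum: "mpoly_eval (sum f A) p = (\<Sum>x\<in>A. mpoly_eval (f x) p)"
  by (induction A rule: infinite_finite_induct) (auto simp: mpoly_eval_add)

lemma mpoly_eval_single: "mpoly_eval (single t a) p = a * (\<Prod>v\<in>UNIV. (p $ v) ^ lookup t v)"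
  by (simp add: mpoly_eval_def)

lemma mpoly_eval_mult: "mpoly_eval (f * g) p = mpoly_eval f p * mpoly_eval g p"
proof -
  have "mpoly_eval (scal a (single s 1) * scal b (single t 1)) p =
      mpoly_eval (scal a (single s 1)) p * mpoly_eval (scal b (single t 1)) p" for a b s t
    by (simp add: scal_single mult_single mpoly_eval_single lookup_add power_add prod.distrib mult_ac)
  then have "mpoly_eval ((\<Sum>s\<in>keys f. scal (lookup f s) (single s 1)) * (\<Sum>t\<in>keys g. scal (lookup g t) (single t 1))) p
    = mpoly_eval (\<Sum>s\<in>keys f. scal (lookup f s) (single s 1)) p * mpoly_eval (\<Sum>t\<in>keys g. scal (lookup g t) (single t 1)) p"
    by (simp add: sum_product mpoly_eval_sum)
  then show ?thesis by (simp flip: sum_monomials)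
qed

lemma mpoly_eval_one [simp]: "mpoly_eval 1 p = 1"
  using mpoly_eval_single[of 0 1 p] by simp

lemma mpoly_eval_power: "mpoly_eval (f ^ n) p = mpoly_eval f p ^ n"
  by (induction n) (auto simp: mpoly_eval_mult)

lemma mpoly_eval_prod: "mpoly_eval (prod f A) p = (\<Prod>x\<in>A. mpoly_eval (f x) p)"
  by (induction A rule: infinite_finite_induct) (auto simp: mpoly_eval_mult)

definition linear_form :: "'k::field ^ 'v::finite \<Rightarrow> ('v, 'k) mpoly" where
  "linear_form c = (\<Sum>v\<in>UNIV. single (single v 1) (c $ v))"

lemma linear_form_add: "linear_form (a + b) = linear_form a + linear_form b"
  by (simp add: linear_form_def single_add sum.distrib)

lemma linear_form_scale: "linear_form (r *s a) = scal r (linear_form a)"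
  by (simp add: linear_form_def MP.scale_sum_right scal_single)

lemma linear_form_axis: "linear_form (axis v 1) = single (single v 1) 1"
proof -
  have "linear_form (axis v 1) = (\<Sum>w\<in>UNIV. if w = v then single (single w 1) 1 else 0)"
    unfolding linear_form_def by (intro sum.cong) (auto simp: axis_def)
  then show ?thesis by simp
qed

lemma linear_form_homogeneous [simp]: "linear_form c \<in> homogeneous_part 1"
  unfolding linear_form_def
  by (intro MP.subspace_sum subspace_homogeneous_part) (metis homogeneous_part_single mdeg_single)

lemma mpoly_eval_linear_form: "mpoly_eval (linear_form c) p = dotp c p"
proof -
  have "(\<Prod>w\<in>UNIV. p $ w ^ lookup (single v (1::nat)) w) = p $ v" for v
  proof -
    have "(\<Prod>w\<in>UNIV. p $ w ^ lookup (single v (1::nat)) w) = (\<Prod>w\<in>UNIV. if w = v then p $ w else 1)"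
      by (intro prod.cong) (auto simp: lookup_single)
    then show ?thesis by simp
  qed
  then show ?thesis by (simp add: linear_form_def mpoly_eval_sum mpoly_eval_single dotp_def)
qed

section \<open>Powers of the ideal of a point\<close>

lemma coord_ring_simps [simp]:
  "carrier coord_ring = UNIV" "mult coord_ring = (*)" "one coord_ring = 1" "zero coord_ring = 0"
  "add coord_ring = (+)"
  by (simp_all add: coord_ring_def)

interpretation CR: cring coord_ring
  by (rule coord_ring_cring)

text \<open>
  The passage between the ideals of the ring structure and the operations of the type of polynomials.
\<close>

lemma ideal_coord_ring_iff:
  "ideal I coord_ring \<longleftrightarrow> 0 \<in> I \<and> (\<forall>f\<in>I. \<forall>g\<in>I. f + g \<in> I) \<and> (\<forall>f\<in>I. \<forall>g. g * f \<in> I)" (is "?l \<longleftrightarrow> ?r")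
proof
  assume ?l
  then interpret ideal I coord_ring .
  show ?r using zero_closed a_closed I_l_closed by auto
next
  assume r: ?r
  have inv: "\<ominus>\<^bsub>coord_ring\<^esub> f = - f" for f :: "('a, 'b) mpoly"
    using CR.add.inv_equality[of "- f" f] by simp
  have neg: "- f \<in> I" if "f \<in> I" for f
    using r that by (metis mult_1 mult_minus_left)
  have "subgroup I (add_monoid coord_ring)"
  proof (rule CR.add.subgroupI)
    show "\<ominus>\<^bsub>coord_ring\<^esub> f \<in> I" if "f \<in> I" for f
      unfolding inv by (rule neg[OF that])
  qed (use r in auto)
  then show ?l using r by (intro idealI CR.ring_axioms) (auto simp: mult.commute)
qed

lemma ideal_subspace: "ideal I coord_ring \<Longrightarrow> MP.subspace I"
  unfolding ideal_coord_ring_iff MP.subspace_def scal_def by blast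

definition point_power :: "'k::field ^ 'v::finite \<Rightarrow> nat \<Rightarrow> ('v, 'k) mpoly set" where
  "point_power p a = point_ideal p [^]\<^bsub>ideals_set coord_ring\<^esub> a"

lemma ideal_point_ideal: "ideal (point_ideal p) coord_ring"
  unfolding point_ideal_def by (intro CR.genideal_ideal) simp

lemma point_power_0: "point_power p 0 = UNIV"
  by (simp add: point_power_def ideals_set_def)

lemma point_power_Suc: "point_power p (Suc a) = ideal_prod coord_ring (point_power p a) (point_ideal p)"
  by (simp add: point_power_def ideals_set_def)

lemma ideal_point_power: "ideal (point_power p a) coord_ring"
proof (induction a)
  case 0
  show ?case by (simp add: point_power_0 ideal_coord_ring_iff)
next
  case (Suc a)
  then show ?case unfolding point_power_Suc by (intro CR.ideal_prod_is_ideal ideal_point_ideal)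
qed

lemma form_in_point_ideal: "f \<in> homogeneous_part d \<Longrightarrow> mpoly_eval f p = 0 \<Longrightarrow> f \<in> point_ideal p"
  unfolding point_ideal_def using CR.genideal_self by fastforce

lemma linear_form_mult_point_power:
  assumes "dotp c p = 0" "F \<in> point_power p a"
  shows "linear_form c * F \<in> point_power p (Suc a)"
proof -
  have "linear_form c \<in> point_ideal p"
    using assms(1) by (intro form_in_point_ideal[OF linear_form_homogeneous]) (simp add: mpoly_eval_linear_form)
  then show ?thesis
    using ideal_prod.prod[OF assms(2), of "linear_form c" "point_ideal p" coord_ring]
    by (simp add: point_power_Suc mult.commute)
qed

lemma point_power_mult: "F \<in> point_power p a \<Longrightarrow> G * F \<in> point_power p a"
  using ideal_point_power[of p a] by (auto simp: ideal_coord_ring_iff)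

lemma point_power_antimono: "a \<le> b \<Longrightarrow> point_power p b \<subseteq> point_power p a"
proof (induction rule: dec_induct)
  case (step b)
  have "point_power p (Suc b) \<subseteq> point_power p b \<inter> point_ideal p"
    unfolding point_power_Suc by (intro CR.ideal_prod_inter ideal_point_power ideal_point_ideal)
  then show ?case using step by blast
qed simp

section \<open>Coordinates adapted to a point\<close>

text \<open>
  The degree in all variables except the one with index \<open>v0\<close>: the order of vanishing of a monomial at the
  coordinate point with nonzero coordinate \<open>v0\<close>.
\<close>

definition codeg :: "'v::finite \<Rightarrow> ('v \<Rightarrow>\<^sub>0 nat) \<Rightarrow> nat" where
  "codeg v0 t = (\<Sum>v\<in>UNIV - {v0}. lookup t v)"

lemma codeg_add: "codeg v0 (s + t) = codeg v0 s + codeg v0 t"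
  by (simp add: codeg_def lookup_add sum.distrib)

lemma codeg_single [simp]: "codeg v0 (single v a) = (if v = v0 then 0 else a)"
  by (simp add: codeg_def lookup_single when_def)

lemma mdeg_eq_codeg: "mdeg t = lookup t v0 + codeg v0 t"
  unfolding mdeg_def codeg_def by (simp add: sum.remove)

lemma exponent_remove:
  assumes "lookup t v \<noteq> (0::nat)"
  shows "\<exists>t'. t = single v 1 + t'"
proof
  show "t = single v 1 + (t - single v 1)"
    using assms by (intro poly_mapping_eqI) (auto simp: lookup_add lookup_minus lookup_single when_def)
qed

lemma bij_exponents_lists:
  fixes d :: nat
  assumes "set vs = (UNIV :: 'v::finite set)" "distinct vs"
  shows "bij_betw (\<lambda>t. map (lookup t) vs) {t :: 'v \<Rightarrow>\<^sub>0 nat. mdeg t = d} {l. length l = CARD('v) \<and> sum_list l = d}"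
  unfolding bij_betw_def
proof
  show "inj_on (\<lambda>t. map (lookup t) vs) {t :: 'v \<Rightarrow>\<^sub>0 nat. mdeg t = d}"
    using assms(1) by (auto intro!: inj_onI poly_mapping_eqI)
  have len: "length vs = CARD('v)" using assms distinct_card by metis
  have sum: "sum_list (map f vs) = (\<Sum>v\<in>UNIV. f v)" for f :: "'v \<Rightarrow> nat"
    using assms sum.distinct_set_conv_list by metis
  show "(\<lambda>t. map (lookup t) vs) ` {t :: 'v \<Rightarrow>\<^sub>0 nat. mdeg t = d} = {l. length l = CARD('v) \<and> sum_list l = d}"
  proof (intro equalityI subsetI)
    fix l assume "l \<in> (\<lambda>t. map (lookup t) vs) ` {t :: 'v \<Rightarrow>\<^sub>0 nat. mdeg t = d}"
    then show "l \<in> {l. length l = CARD('v) \<and> sum_list l = d}"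
      by (auto simp: len sum mdeg_def)
  next
    fix l :: "nat list" assume l: "l \<in> {l. length l = CARD('v) \<and> sum_list l = d}"
    define f where "f v = (case map_of (zip vs l) v of Some a \<Rightarrow> a | None \<Rightarrow> 0)" for v
    have f: "map f vs = l"
      using l len assms(2) unfolding f_def by (intro nth_equalityI) (auto simp: map_of_zip_nth)
    have "lookup (Abs_poly_mapping f) = f" by simp
    then have "map (lookup (Abs_poly_mapping f)) vs = l" "mdeg (Abs_poly_mapping f) = d"
      using f l sum[of f] by (auto simp: mdeg_def)
    then show "l \<in> (\<lambda>t. map (lookup t) vs) ` {t :: 'v \<Rightarrow>\<^sub>0 nat. mdeg t = d}" by blast
  qed
qed

lemma finite_exponents: "finite {t :: 'v::finite \<Rightarrow>\<^sub>0 nat. mdeg t = d}"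
  and card_exponents: "card {t :: 'v::finite \<Rightarrow>\<^sub>0 nat. mdeg t = d} = (d + CARD('v) - 1) choose d"
proof -
  obtain vs :: "'v list" where vs: "set vs = UNIV" "distinct vs"
    using finite_distinct_list[OF finite_class.finite_UNIV] by blast
  have "{l :: nat list. length l = CARD('v) \<and> sum_list l = d} \<subseteq> {l. set l \<subseteq> {..d} \<and> length l = CARD('v)}"
    using member_le_sum_list by fastforce
  then have "finite {l :: nat list. length l = CARD('v) \<and> sum_list l = d}"
    by (rule finite_subset) (intro finite_lists_length_eq finite_atMost)
  then show "finite {t :: 'v::finite \<Rightarrow>\<^sub>0 nat. mdeg t = d}"
    using bij_betw_finite[OF bij_exponents_lists[OF vs]] by blast
  show "card {t :: 'v::finite \<Rightarrow>\<^sub>0 nat. mdeg t = d} = (d + CARD('v) - 1) choose d"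
    using bij_betw_same_card[OF bij_exponents_lists[OF vs]] by (simp add: card_length_sum_list)
qed

text \<open>
  The exponent of the variable \<open>v0\<close> is at least \<open>B + 1 - a\<close>, and subtracting this amount leaves an arbitrary
  monomial of degree \<open>a - 1\<close> in all the variables.
\<close>

lemma card_exponents_low_codeg:
  fixes v0 :: "'v::finite"
  assumes "1 \<le> a" "a \<le> Suc B"
  shows "card {t. mdeg t = B \<and> codeg v0 t < a} = (a + (CARD('v) - 1) - 1) choose (CARD('v) - 1)"
proof -
  let ?s = "single v0 (Suc B - a)"
  have "bij_betw ((+) ?s) {t. mdeg t = a - 1} {t. mdeg t = B \<and> codeg v0 t < a}"
    unfolding bij_betw_def
  proof
    show "inj_on ((+) ?s) {t. mdeg t = a - 1}" by simp
    show "(+) ?s ` {t. mdeg t = a - 1} = {t. mdeg t = B \<and> codeg v0 t < a}"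
    proof (intro equalityI subsetI)
      fix t assume "t \<in> (+) ?s ` {t. mdeg t = a - 1}"
      then obtain u where u: "t = ?s + u" "mdeg u = a - 1" by blast
      then have "codeg v0 u \<le> a - 1" using mdeg_eq_codeg[of u v0] by simp
      then show "t \<in> {t. mdeg t = B \<and> codeg v0 t < a}" using u assms by (auto simp: mdeg_add codeg_add)
    next
      fix t assume t: "t \<in> {t. mdeg t = B \<and> codeg v0 t < a}"
      define u where "u = t - ?s"
      have "Suc B - a \<le> lookup t v0" using t mdeg_eq_codeg[of t v0] by auto
      then have eq: "?s + u = t" unfolding u_def
        by (intro poly_mapping_eqI) (auto simp: lookup_add lookup_minus lookup_single when_def)
      have "mdeg ?s + mdeg u = mdeg t" unfolding mdeg_add[symmetric] eq ..
      then have "mdeg u = a - 1" using t assms by auto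
      then show "t \<in> (+) ?s ` {t. mdeg t = a - 1}" using eq by blast
    qed
  qed
  then have "card {t. mdeg t = B \<and> codeg v0 t < a} = card {t :: 'v \<Rightarrow>\<^sub>0 nat. mdeg t = a - 1}"
    by (rule bij_betw_same_card[symmetric])
  also have "\<dots> = (a - 1 + CARD('v) - 1) choose (a - 1)" by (rule card_exponents)
  also have "\<dots> = (a + (CARD('v) - 1) - 1) choose (CARD('v) - 1)"
  proof -
    have "CARD('v) \<ge> 1" by (simp add: Suc_le_eq)
    then have eq: "a - 1 + CARD('v) - 1 = (a - 1) + (CARD('v) - 1)"
      "a + (CARD('v) - 1) - 1 = (a - 1) + (CARD('v) - 1)"
      using assms by auto
    show ?thesis unfolding eq
      using binomial_symmetric[of "a - 1" "a - 1 + (CARD('v) - 1)"] by (simp only: le_add1 add_diff_cancel_left' simp_thms)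
  qed
  finally show ?thesis .
qed

text \<open>
  For a point \<open>P\<close> with \<open>P $ v0 \<noteq> 0\<close>, the forms \<open>x\<^sub>u - (P\<^sub>u / P\<^sub>v\<^sub>0) x\<^sub>v\<^sub>0\<close> with \<open>u \<noteq> v0\<close> vanish at \<open>P\<close>, and together
  with \<open>x\<^sub>v\<^sub>0\<close> they are coordinates. The monomials in these coordinates are a basis of the polynomials in
  which \<open>I\<^sub>P\<^sup>a\<close> is spanned by basis elements.
\<close>

locale adapted_coordinates =
  fixes P :: "'k::field ^ 'v::finite" and v0 :: 'v
  assumes pivot: "P $ v0 \<noteq> 0"
begin

definition slope :: "'v \<Rightarrow> 'k" where
  "slope u = (if u = v0 then 0 else P $ u / P $ v0)"

definition yvec :: "'v \<Rightarrow> 'k ^ 'v" where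
  "yvec u = axis u 1 + (- slope u) *s axis v0 1"

definition ymon :: "('v \<Rightarrow>\<^sub>0 nat) \<Rightarrow> ('v, 'k) mpoly" where
  "ymon t = (\<Prod>u\<in>UNIV. linear_form (yvec u) ^ lookup t u)"

lemma dotp_yvec: "dotp (yvec u) P = (if u = v0 then P $ v0 else 0)"
  using pivot unfolding yvec_def dotp_add_left dotp_scale_left dotp_axis slope_def by simp

lemma variable_eq: "single (single u 1) 1 = linear_form (yvec u) + scal (slope u) (linear_form (yvec v0))"
proof -
  have "axis u 1 = yvec u + slope u *s yvec v0"
    by (simp add: yvec_def slope_def vec_eq_iff)
  then have "linear_form (axis u 1) = linear_form (yvec u + slope u *s yvec v0)" by simp
  then show ?thesis by (simp only: linear_form_axis linear_form_add linear_form_scale)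
qed

lemma ymon_zero [simp]: "ymon 0 = 1"
  by (simp add: ymon_def)

lemma ymon_add: "ymon (s + t) = ymon s * ymon t"
  by (simp add: ymon_def lookup_add power_add prod.distrib)

lemma ymon_single: "ymon (single u 1) = linear_form (yvec u)"
proof -
  have "ymon (single u 1) = (\<Prod>w\<in>UNIV. if w = u then linear_form (yvec w) else 1)"
    unfolding ymon_def by (intro prod.cong) (auto simp: lookup_single)
  then show ?thesis by simp
qed

lemma ymon_homogeneous: "ymon t \<in> homogeneous_part (mdeg t)"
proof -
  have "ymon t \<in> homogeneous_part (\<Sum>u\<in>UNIV. lookup t u * 1)"
    unfolding ymon_def by (intro homogeneous_part_prod homogeneous_part_power linear_form_homogeneous) simp
  then show ?thesis by (simp add: mdeg_def)
qed

lemma eval_ymon: "codeg v0 t \<noteq> 0 \<Longrightarrow> mpoly_eval (ymon t) P = 0"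
  by (auto simp: ymon_def mpoly_eval_prod mpoly_eval_power mpoly_eval_linear_form dotp_yvec codeg_def
      power_0_left)

lemma eval_ymon_nonzero: "codeg v0 t = 0 \<Longrightarrow> mpoly_eval (ymon t) P \<noteq> 0"
  using pivot by (auto simp: ymon_def mpoly_eval_prod mpoly_eval_power mpoly_eval_linear_form dotp_yvec codeg_def)

abbreviation exps :: "nat \<Rightarrow> ('v \<Rightarrow>\<^sub>0 nat) set" where
  "exps d \<equiv> {t. mdeg t = d}"

text \<open>
  Multiplication by a monomial shifts exponents, so it can be checked on exponents that it maps one span
  of monomials into another.
\<close>

lemma ymon_mult_span:
  assumes "f \<in> MP.span (ymon ` A)" "\<And>t. t \<in> A \<Longrightarrow> s + t \<in> A'"
  shows "ymon s * f \<in> MP.span (ymon ` A')"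
  using assms(1)
proof (induction rule: MP.span_induct_alt)
  case base
  show ?case using MP.span_zero by simp
next
  case (step c x y)
  then obtain t where t: "x = ymon t" "t \<in> A" by blast
  have "ymon s * (scal c x + y) = scal c (ymon (s + t)) + ymon s * y"
    by (simp add: t distrib_left scal_mult_right ymon_add)
  moreover have "ymon (s + t) \<in> MP.span (ymon ` A')"
    using assms(2)[OF t(2)] by (intro MP.span_base imageI)
  ultimately show ?case using step(2) by (simp add: MP.span_add MP.span_scale)
qed

lemma monomial_in_span: "single t 1 \<in> MP.span (ymon ` exps (mdeg t))"
proof (induction "mdeg t" arbitrary: t)
  case 0
  then have "t = 0" by (intro poly_mapping_eqI) (simp add: mdeg_def)
  then show ?case using MP.span_base[of "1" "ymon ` exps 0"] by (force intro: image_eqI[of _ _ 0])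
next
  case (Suc d)
  then have "\<exists>u. lookup t u \<noteq> 0" by (metis mdeg_def nat.distinct(1) sum.neutral)
  then obtain u where "lookup t u \<noteq> 0" by blast
  from exponent_remove[OF this] obtain t' where t': "t = single u 1 + t'" by blast
  then have d: "mdeg t' = d" using Suc(2) by (simp add: mdeg_add)
  have IH: "single t' 1 \<in> MP.span (ymon ` exps d)" using Suc(1)[of t'] d by simp
  have "ymon (single w 1) * single t' 1 \<in> MP.span (ymon ` exps (Suc d))" for w
    by (rule ymon_mult_span[OF IH]) (simp add: mdeg_add)
  moreover have "single t 1 = ymon (single u 1) * single t' 1 + scal (slope u) (ymon (single v0 1) * single t' 1)"
  proof -
    have "single t (1::'k) = single (single u 1) 1 * single t' 1" by (simp add: t' mult_single)
    then show ?thesis unfolding variable_eq ymon_single by (simp add: distrib_right scal_mult_left)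
  qed
  ultimately show ?case unfolding Suc(2)[symmetric] by (metis MP.span_add MP.span_scale)
qed

lemma span_ymon: "MP.span (ymon ` exps d) = homogeneous_part d"
proof
  show "MP.span (ymon ` exps d) \<subseteq> homogeneous_part d"
    using ymon_homogeneous by (intro MP.span_minimal subspace_homogeneous_part) auto
  show "homogeneous_part d \<subseteq> MP.span (ymon ` exps d)"
  proof
    fix f :: "('v, 'k) mpoly" assume f: "f \<in> homogeneous_part d"
    have "f = (\<Sum>t\<in>keys f. scal (lookup f t) (single t 1))" by (rule sum_monomials) auto
    moreover have "scal (lookup f t) (single t 1) \<in> MP.span (ymon ` exps d)" if "t \<in> keys f" for t
      using monomial_in_span[of t] f that by (intro MP.span_scale) (auto simp: homogeneous_part_iff in_keys_iff)
    ultimately show "f \<in> MP.span (ymon ` exps d)" by (metis (no_types, lifting) MP.span_sum)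
  qed
qed

text \<open>
  The ordinary monomials of degree \<open>d\<close> are linearly independent. The bound makes the monomials in
  the adapted coordinates, which span the forms of degree \<open>d\<close> and have the same exponents, linearly
  independent as well.
\<close>

lemma card_le_card_spanning:
  assumes "finite Y" "homogeneous_part d \<subseteq> MP.span (Y :: ('v, 'k) mpoly set)"
  shows "card (exps d) \<le> card Y"
proof -
  let ?m = "\<lambda>t. single t (1::'k)"
  have inj: "inj_on ?m (exps d)"
    by (intro inj_onI) (metis keys_single singleton_insert_inj_eq zero_neq_one)
  have "MP.independent (?m ` exps d)"
  proof (rule MP.independent_if_scalars_zero)
    fix f x assume 0: "(\<Sum>x\<in>?m ` exps d. scal (f x) x) = 0" and "x \<in> ?m ` exps d"
    then obtain t where t: "x = ?m t" "mdeg t = d" by blast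
    have "(\<Sum>s\<in>exps d. scal (f (?m s)) (?m s)) = 0" using 0 by (simp add: sum.reindex[OF inj])
    then have "lookup (\<Sum>s\<in>exps d. scal (f (?m s)) (?m s)) t = 0" by simp
    then have "(\<Sum>s\<in>exps d. if s = t then f (?m s) else 0) = 0"
      by (simp add: lookup_sum scal_single lookup_single when_def)
    then show "f x = 0" using t finite_exponents[where d = d and 'v = 'v] by (simp add: sum.delta[OF finite_exponents])
  qed (simp add: finite_exponents)
  moreover have "?m ` exps d \<subseteq> MP.span Y" using assms(2) by (force simp: homogeneous_part_iff lookup_single when_def)
  ultimately have "card (?m ` exps d) \<le> card Y" using MP.independent_span_bound[OF assms(1)] by blast
  then show ?thesis by (simp add: card_image[OF inj])
qed

lemma inj_ymon: "inj_on ymon (exps d)"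
proof -
  have "card (exps d) \<le> card (ymon ` exps d)"
    using span_ymon[of d] finite_exponents[of d] by (intro card_le_card_spanning) auto
  then show ?thesis
    using finite_exponents[of d] by (intro eq_card_imp_inj_on antisym card_image_le) auto
qed

lemma independent_ymon: "MP.independent (ymon ` exps d)"
proof
  assume "MP.dependent (ymon ` exps d)"
  then obtain x where x: "x \<in> ymon ` exps d" "x \<in> MP.span (ymon ` exps d - {x})"
    unfolding MP.dependent_def by blast
  have "MP.span (ymon ` exps d - {x}) = homogeneous_part d"
    using MP.span_redundant[OF x(2)] x(1) by (simp add: insert_absorb span_ymon)
  then have "card (exps d) \<le> card (ymon ` exps d - {x})"
    using finite_exponents[of d] by (intro card_le_card_spanning) auto
  also have "\<dots> < card (ymon ` exps d)" using x(1) finite_exponents[of d] by (intro card_Diff1_less) auto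
  finally show False using card_image_le[OF finite_exponents[of d], of ymon] by simp
qed

lemma ymon_coeffs_zero:
  assumes "(\<Sum>t\<in>exps d. scal (c t) (ymon t)) = 0" "t \<in> exps d"
  shows "c t = 0"
proof -
  let ?g = "\<lambda>x. c (the_inv_into (exps d) ymon x)"
  have "(\<Sum>x\<in>ymon ` exps d. scal (?g x) x) = (\<Sum>t\<in>exps d. scal (c t) (ymon t))"
    by (simp add: sum.reindex[OF inj_ymon] the_inv_into_f_f[OF inj_ymon])
  then have "(\<Sum>x\<in>ymon ` exps d. scal (?g x) x) = 0" using assms(1) by simp
  then have "?g (ymon t) = 0"
    using assms(2) finite_exponents[of d] by (intro MP.independentD[OF independent_ymon]) auto
  then show ?thesis using assms(2) by (simp add: the_inv_into_f_f[OF inj_ymon])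
qed

lemma span_ymon_coeffs:
  assumes "finite A" "f \<in> MP.span (ymon ` A)"
  shows "\<exists>c. f = (\<Sum>t\<in>A. scal (c t) (ymon t))"
  using assms(2)
proof (induction rule: MP.span_induct_alt)
  case base
  show ?case by (intro exI[of _ "\<lambda>_. 0"]) simp
next
  case (step r x y)
  then obtain s c where s: "x = ymon s" "s \<in> A" "y = (\<Sum>t\<in>A. scal (c t) (ymon t))" by blast
  have "(\<Sum>t\<in>A. scal (if t = s then r else 0) (ymon t)) = (\<Sum>t\<in>A. if t = s then scal r (ymon t) else 0)"
    by (intro sum.cong) auto
  also have "\<dots> = scal r (ymon s)" using s(2) assms(1) by simp
  finally have "scal r x + y = (\<Sum>t\<in>A. scal ((if t = s then r else 0) + c t) (ymon t))"
    by (simp only: s MP.scale_left_distrib sum.distrib)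
  then show ?case by (rule exI[of _ "\<lambda>t. (if t = s then r else 0) + c t"])
qed

lemma span_all_ymon: "MP.span (range ymon) = UNIV"
proof -
  have "f \<in> MP.span (range ymon)" for f
  proof -
    have "f = (\<Sum>t\<in>keys f. scal (lookup f t) (single t 1))" by (rule sum_monomials) auto
    moreover have "single t 1 \<in> MP.span (range ymon)" for t
      using monomial_in_span[of t] MP.span_mono[of "ymon ` exps (mdeg t)" "range ymon"] by blast
    ultimately show ?thesis by (metis (no_types, lifting) MP.span_sum MP.span_scale)
  qed
  then show ?thesis by blast
qed

text \<open>
  The explicit description of \<open>I\<^sub>P\<^sup>a\<close>; see \<open>point_power_eq\<close>.
\<close>

definition vanishing :: "nat \<Rightarrow> ('v, 'k) mpoly set" where
  "vanishing a = MP.span (ymon ` {t. a \<le> codeg v0 t})"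

lemma ymon_mult_vanishing:
  assumes "f \<in> vanishing a" "b \<le> a + codeg v0 s"
  shows "ymon s * f \<in> vanishing b"
  unfolding vanishing_def
  by (rule ymon_mult_span[OF assms(1)[unfolded vanishing_def]]) (use assms(2) in \<open>auto simp: codeg_add\<close>)

lemma vanishing_mult:
  assumes "f \<in> vanishing a" "g \<in> MP.span (ymon ` {t. b \<le> codeg v0 t})"
  shows "g * f \<in> vanishing (a + b)"
  using assms(2)
proof (induction rule: MP.span_induct_alt)
  case base
  show ?case by (simp add: vanishing_def MP.span_zero)
next
  case (step c x y)
  then obtain t where "x = ymon t" "b \<le> codeg v0 t" by blast
  then have "x * f \<in> vanishing (a + b)" using ymon_mult_vanishing[OF assms(1)] by simp
  then show ?case using step(2) unfolding vanishing_def
    by (simp add: distrib_right scal_mult_left MP.span_add MP.span_scale)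
qed

lemma ideal_vanishing: "ideal (vanishing a) coord_ring"
proof -
  have "g * f \<in> vanishing a" if "f \<in> vanishing a" for f g
    using vanishing_mult[OF that, of g 0] span_all_ymon by simp
  then show ?thesis unfolding ideal_coord_ring_iff
    by (auto simp: vanishing_def MP.span_zero MP.span_add)
qed

text \<open>
  In a form of degree \<open>d\<close> the only monomial in adapted coordinates that does not vanish at \<open>P\<close> is the
  \<open>d\<close>-th power of \<open>x\<^sub>v\<^sub>0\<close>, so the form vanishes at \<open>P\<close> exactly if this monomial is missing.
\<close>

lemma point_ideal_eq: "point_ideal P = vanishing 1"
proof
  have "f \<in> vanishing 1" if f: "f \<in> homogeneous_part d" "mpoly_eval f P = 0" for f d
  proof -
    obtain c where c: "f = (\<Sum>t\<in>exps d. scal (c t) (ymon t))"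
      using span_ymon_coeffs[OF finite_exponents[of d]] f(1) span_ymon[of d] by blast
    let ?t0 = "single v0 d"
    have codeg0: "codeg v0 t = 0 \<longleftrightarrow> t = ?t0" if "t \<in> exps d" for t
    proof
      assume 0: "codeg v0 t = 0"
      then have "lookup t v0 = d" using mdeg_eq_codeg[of t v0] that by simp
      then show "t = ?t0" using 0
        by (intro poly_mapping_eqI) (auto simp: lookup_single when_def codeg_def)
    qed simp
    have "0 = (\<Sum>t\<in>exps d. c t * mpoly_eval (ymon t) P)"
      using f(2) by (simp add: c mpoly_eval_sum mpoly_eval_scal)
    also have "\<dots> = (\<Sum>t\<in>exps d. if t = ?t0 then c t * mpoly_eval (ymon t) P else 0)"
      using codeg0 eval_ymon by (intro sum.cong) auto
    also have "\<dots> = c ?t0 * mpoly_eval (ymon ?t0) P" by (simp add: sum.delta[OF finite_exponents])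
    finally have "c ?t0 = 0" using eval_ymon_nonzero[of ?t0] by simp
    have "scal (c t) (ymon t) \<in> vanishing 1" if "t \<in> exps d" for t
    proof (cases "t = ?t0")
      case True
      then show ?thesis using \<open>c ?t0 = 0\<close> by (simp add: vanishing_def MP.span_zero)
    next
      case False
      then show ?thesis using codeg0[OF that] unfolding vanishing_def
        by (intro MP.span_scale MP.span_base) auto
    qed
    then show ?thesis unfolding c using ideal_subspace[OF ideal_vanishing] by (intro MP.subspace_sum)
  qed
  then show "point_ideal P \<subseteq> vanishing 1"
    unfolding point_ideal_def by (intro CR.genideal_minimal ideal_vanishing) auto
  have "ymon t \<in> point_ideal P" if "1 \<le> codeg v0 t" for t
    unfolding point_ideal_def using CR.genideal_self[of "{f. (\<exists>d. f \<in> homogeneous_part d) \<and> mpoly_eval f P = 0}"]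
      ymon_homogeneous[of t] eval_ymon[of t] that by fastforce
  then show "vanishing 1 \<subseteq> point_ideal P" unfolding vanishing_def
    by (intro MP.span_minimal ideal_subspace ideal_point_ideal) auto
qed

lemma point_power_eq: "point_power P a = vanishing a"
proof (induction a)
  case 0
  show ?case by (simp add: point_power_0 vanishing_def span_all_ymon)
next
  case (Suc a)
  have "ideal_prod coord_ring (vanishing a) (vanishing 1) = vanishing (Suc a)"
  proof
    have "f \<in> vanishing (Suc a)" if "f \<in> ideal_prod coord_ring (vanishing a) (vanishing 1)" for f
      using that
    proof (induction rule: ideal_prod.induct)
      case (prod i j)
      then show ?case using vanishing_mult[of i a j 1] by (simp add: vanishing_def mult.commute)
    next
      case (sum s1 s2)
      then show ?case by (simp add: vanishing_def MP.span_add)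
    qed
    then show "ideal_prod coord_ring (vanishing a) (vanishing 1) \<subseteq> vanishing (Suc a)" by blast
    have "ymon t \<in> ideal_prod coord_ring (vanishing a) (vanishing 1)" if t: "Suc a \<le> codeg v0 t" for t
    proof -
      have "\<exists>u\<in>UNIV - {v0}. lookup t u \<noteq> 0" using t unfolding codeg_def by (metis not_less_eq_eq sum.neutral zero_le)
      then obtain u where u0: "u \<in> UNIV - {v0}" "lookup t u \<noteq> 0" by blast
      from exponent_remove[OF u0(2)] obtain t' where "t = single u 1 + t'" by blast
      then have u: "u \<noteq> v0" "t = single u 1 + t'" using u0(1) by auto
      then have "a \<le> codeg v0 t'" using t by (simp add: codeg_add)
      then have "ymon t' \<in> vanishing a" "ymon (single u 1) \<in> vanishing 1"
        using u(1) unfolding vanishing_def by (auto intro!: MP.span_base imageI)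
      from ideal_prod.prod[OF this, of coord_ring] show ?thesis by (simp add: u(2) ymon_add mult.commute)
    qed
    then show "vanishing (Suc a) \<subseteq> ideal_prod coord_ring (vanishing a) (vanishing 1)"
      unfolding vanishing_def[of "Suc a"]
      by (intro MP.span_minimal ideal_subspace CR.ideal_prod_is_ideal ideal_vanishing) auto
  qed
  then show ?case by (simp add: point_power_Suc Suc point_ideal_eq)
qed

text \<open>
  Collect the terms of degree \<open>d\<close> in a combination of monomials; the others must cancel.
\<close>

lemma vanishing_homogeneous:
  assumes "f \<in> vanishing a" "f \<in> homogeneous_part d"
  shows "f \<in> MP.span (ymon ` {t. mdeg t = d \<and> a \<le> codeg v0 t})"
proof -
  have "\<exists>g h. f = g + h \<and> g \<in> MP.span (ymon ` {t. mdeg t = d \<and> a \<le> codeg v0 t}) \<and>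
      (\<forall>s. mdeg s = d \<longrightarrow> lookup h s = 0)"
    using assms(1) unfolding vanishing_def
  proof (induction rule: MP.span_induct_alt)
    case base
    show ?case by (intro exI[of _ 0]) (simp add: MP.span_zero)
  next
    case (step c x y)
    then obtain t g h where t: "x = ymon t" "a \<le> codeg v0 t" and gh: "y = g + h"
      "g \<in> MP.span (ymon ` {t. mdeg t = d \<and> a \<le> codeg v0 t})" "\<forall>s. mdeg s = d \<longrightarrow> lookup h s = 0" by blast
    show ?case
    proof (cases "mdeg t = d")
      case True
      then have "scal c x + g \<in> MP.span (ymon ` {t. mdeg t = d \<and> a \<le> codeg v0 t})"
        using t by (intro MP.span_add MP.span_scale gh(2) MP.span_base[of x]) auto
      then show ?thesis using gh by (intro exI[of _ "scal c x + g"] exI[of _ h]) (simp add: add.assoc)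
    next
      case False
      then have "\<forall>s. mdeg s = d \<longrightarrow> lookup (scal c x + h) s = 0"
        using ymon_homogeneous[of t] gh(3) by (auto simp: homogeneous_part_iff t lookup_add lookup_scal)
      then show ?thesis using gh by (intro exI[of _ g] exI[of _ "scal c x + h"]) (simp add: add_ac)
    qed
  qed
  then obtain g h where gh: "f = g + h" "g \<in> MP.span (ymon ` {t. mdeg t = d \<and> a \<le> codeg v0 t})"
    "\<forall>s. mdeg s = d \<longrightarrow> lookup h s = 0" by blast
  have "g \<in> homogeneous_part d"
    using gh(2) MP.span_mono[of "ymon ` {t. mdeg t = d \<and> a \<le> codeg v0 t}" "ymon ` exps d"] span_ymon[of d] by blast
  then have "h = 0" using gh(1,3) assms(2)
    by (intro poly_mapping_eqI) (metis add_0 homogeneous_part_iff lookup_add lookup_zero)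
  then show ?thesis using gh by simp
qed

end

section \<open>The Hilbert function read off a basis modulo an ideal\<close>

text \<open>
  Forms that are a basis of \<open>R\<^sub>d\<close> modulo \<open>I\<close> give the Hilbert function by their number: their classes build up
  the degree \<open>d\<close> part of the quotient ring by successive line extensions.
\<close>

lemma hilbert_function_eq_card:
  fixes I :: "('v::finite, 'k::field) mpoly set" and b :: "'i \<Rightarrow> ('v, 'k) mpoly"
  assumes I: "ideal I coord_ring" and proper: "1 \<notin> I" and fin: "finite J"
    and hom: "\<And>k. k \<in> J \<Longrightarrow> b k \<in> homogeneous_part d"
    and indep: "\<And>c k. (\<Sum>k\<in>J. scal (c k) (b k)) \<in> I \<Longrightarrow> k \<in> J \<Longrightarrow> c k = 0"
    and spanning: "\<And>f. f \<in> homogeneous_part d \<Longrightarrow> \<exists>c. f - (\<Sum>k\<in>J. scal (c k) (b k)) \<in> I"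
  shows "hilbert_function I d = card J"
proof -
  interpret I: ideal I coord_ring by fact
  let ?Q = "coord_ring Quot I"
  define cls where "cls f = I +>\<^bsub>coord_ring\<^esub> f" for f
  interpret Q: cring ?Q by (rule I.quotient_is_cring[OF coord_ring_cring])
  interpret pi: ring_hom_ring coord_ring ?Q cls
    unfolding cls_def by (rule I.rcos_ring_hom_ring)
  have I_facts: "0 \<in> I" "\<And>f g. f \<in> I \<Longrightarrow> g \<in> I \<Longrightarrow> f + g \<in> I" "\<And>f g. f \<in> I \<Longrightarrow> g * f \<in> I"
    using I unfolding ideal_coord_ring_iff by blast+
  have I_sub: "MP.subspace I" using I by (rule ideal_subspace)
  have in_cls: "x \<in> cls f \<longleftrightarrow> x - f \<in> I" for x f
    unfolding cls_def a_r_coset_def' by (auto intro!: bexI[of _ "x - f"])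
  have cls_eq_iff: "cls f = cls g \<longleftrightarrow> f - g \<in> I" for f g
  proof
    assume "cls f = cls g"
    then show "f - g \<in> I" using in_cls[of f f] in_cls[of f g] I_facts(1) by simp
  next
    assume fg: "f - g \<in> I"
    have "x - f \<in> I \<longleftrightarrow> x - g \<in> I" for x
      using MP.subspace_add[OF I_sub _ fg, of "x - f"] MP.subspace_diff[OF I_sub _ fg, of "x - g"] by auto
    then show "cls f = cls g" by (auto simp: in_cls)
  qed
  have cls_zero_iff: "cls f = \<zero>\<^bsub>?Q\<^esub> \<longleftrightarrow> f \<in> I" for f
    using cls_eq_iff[of f 0] pi.hom_zero by simp
  have cls_mult: "cls f \<otimes>\<^bsub>?Q\<^esub> cls g = cls (f * g)" and cls_add: "cls f \<oplus>\<^bsub>?Q\<^esub> cls g = cls (f + g)"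
    and cls_carrier: "cls f \<in> carrier ?Q" and cls_one: "\<one>\<^bsub>?Q\<^esub> = cls 1" for f g
    using pi.hom_mult[of f g] pi.hom_add[of f g] pi.hom_closed[of f] pi.hom_one by auto
  have cls_uminus: "\<ominus>\<^bsub>?Q\<^esub> cls f = cls (- f)" for f
    using cls_add[of "- f" f] cls_carrier cls_zero_iff I_facts(1) by (intro Q.minus_equality) auto
  define F where "F = (\<lambda>c. cls (single 0 c)) ` (UNIV :: 'k set)"
  have single_one: "single (0 :: 'v \<Rightarrow>\<^sub>0 nat) (1 :: 'k) = 1" by simp
  have const_in_I: "single 0 c \<in> I \<longleftrightarrow> c = 0" for c
  proof
    assume c: "single 0 c \<in> I"
    show "c = 0"
    proof (rule ccontr)
      assume "c \<noteq> 0"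
      then have "single 0 (inverse c) * single 0 c = (1 :: ('v, 'k) mpoly)" by (simp add: mult_single)
      then show False using I_facts(3)[OF c] proper by metis
    qed
  qed (simp add: I_facts(1))
  have F: "subfield F ?Q"
  proof (rule Q.subfieldI)
    show "subcring F ?Q"
    proof (rule Q.subcringI', rule Q.subringI)
      show "F \<subseteq> carrier ?Q" unfolding F_def using cls_carrier by auto
      show "\<one>\<^bsub>?Q\<^esub> \<in> F" unfolding F_def cls_one by (intro image_eqI[of _ _ 1]) simp_all
      show "\<ominus>\<^bsub>?Q\<^esub> h \<in> F" if "h \<in> F" for h
        using that unfolding F_def by (auto simp: cls_uminus simp flip: single_uminus)
      show "h1 \<otimes>\<^bsub>?Q\<^esub> h2 \<in> F" "h1 \<oplus>\<^bsub>?Q\<^esub> h2 \<in> F" if "h1 \<in> F" "h2 \<in> F" for h1 h2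
        using that unfolding F_def by (auto simp: cls_mult cls_add mult_single simp flip: single_add)
    qed
    show "Units (?Q\<lparr>carrier := F\<rparr>) = F - {\<zero>\<^bsub>?Q\<^esub>}"
    proof (intro equalityI subsetI)
      fix x assume x: "x \<in> Units (?Q\<lparr>carrier := F\<rparr>)"
      then obtain y where xy: "x \<in> F" "y \<in> F" "x \<otimes>\<^bsub>?Q\<^esub> y = \<one>\<^bsub>?Q\<^esub>" unfolding Units_def by auto
      obtain c e where ce: "x = cls (single 0 c)" "y = cls (single 0 e)" using xy unfolding F_def by auto
      have "x \<noteq> \<zero>\<^bsub>?Q\<^esub>"
      proof
        assume "x = \<zero>\<^bsub>?Q\<^esub>"
        then have "\<one>\<^bsub>?Q\<^esub> = \<zero>\<^bsub>?Q\<^esub>" using xy(3) ce cls_carrier by (metis Q.l_null)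
        then show False using proper cls_zero_iff by (simp add: cls_one)
      qed
      then show "x \<in> F - {\<zero>\<^bsub>?Q\<^esub>}" using xy(1) by simp
    next
      fix x assume x: "x \<in> F - {\<zero>\<^bsub>?Q\<^esub>}"
      then obtain c where c: "x = cls (single 0 c)" unfolding F_def by auto
      then have "c \<noteq> 0" using x cls_zero_iff const_in_I by auto
      then have "cls (single 0 (inverse c)) \<otimes>\<^bsub>?Q\<^esub> x = \<one>\<^bsub>?Q\<^esub>" "x \<otimes>\<^bsub>?Q\<^esub> cls (single 0 (inverse c)) = \<one>\<^bsub>?Q\<^esub>"
        by (simp_all add: c cls_mult mult_single cls_one)
      then show "x \<in> Units (?Q\<lparr>carrier := F\<rparr>)" using x unfolding Units_def F_def by auto
    qed
  qed
  define E where "E J' = {cls (\<Sum>k\<in>J'. scal (c k) (b k)) | c. True}" for J'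
  have dim: "Q.dimension (card J') F (E J')" if "J' \<subseteq> J" for J'
    using finite_subset[OF that fin] that
  proof (induction J' rule: finite_induct)
    case empty
    have "E {} = {\<zero>\<^bsub>?Q\<^esub>}" unfolding E_def using cls_zero_iff[of 0] I_facts(1) by simp
    then show ?case by simp
  next
    case (insert j J')
    have "E (insert j J') = Q.line_extension F (cls (b j)) (E J')"
    proof (intro equalityI subsetI)
      fix x assume "x \<in> E (insert j J')"
      then obtain c where c: "x = cls (\<Sum>k\<in>insert j J'. scal (c k) (b k))" unfolding E_def by blast
      have "x = (cls (single 0 (c j)) \<otimes>\<^bsub>?Q\<^esub> cls (b j)) \<oplus>\<^bsub>?Q\<^esub> cls (\<Sum>k\<in>J'. scal (c k) (b k))"
        using insert(1,2) by (simp add: c cls_mult cls_add scal_def)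
      then show "x \<in> Q.line_extension F (cls (b j)) (E J')"
        unfolding Q.line_extension_def set_add_def' r_coset_def F_def E_def by auto
    next
      fix x assume "x \<in> Q.line_extension F (cls (b j)) (E J')"
      then obtain a c where ac: "x = (cls (single 0 a) \<otimes>\<^bsub>?Q\<^esub> cls (b j)) \<oplus>\<^bsub>?Q\<^esub> cls (\<Sum>k\<in>J'. scal (c k) (b k))"
        unfolding Q.line_extension_def set_add_def' r_coset_def F_def E_def by auto
      have "(\<Sum>k\<in>J'. scal ((c(j := a)) k) (b k)) = (\<Sum>k\<in>J'. scal (c k) (b k))"
        using insert(2) by (intro sum.cong) auto
      then have "x = cls (\<Sum>k\<in>insert j J'. scal ((c(j := a)) k) (b k))"
        using insert(1,2) by (simp add: ac cls_mult cls_add scal_def)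
      then show "x \<in> E (insert j J')" unfolding E_def by blast
    qed
    moreover have "cls (b j) \<notin> E J'"
    proof
      assume "cls (b j) \<in> E J'"
      then obtain c where c: "cls (b j) = cls (\<Sum>k\<in>J'. scal (c k) (b k))" unfolding E_def by blast
      let ?c = "\<lambda>k. if k = j then 1 else if k \<in> J' then - c k else 0"
      have "(\<Sum>k\<in>J. scal (?c k) (b k)) = (\<Sum>k\<in>insert j J'. scal (?c k) (b k))"
        using insert(4) fin by (intro sum.mono_neutral_right) auto
      also have "\<dots> = b j + (\<Sum>k\<in>J'. scal (?c k) (b k))" using insert(1,2) by simp
      also have "(\<Sum>k\<in>J'. scal (?c k) (b k)) = (\<Sum>k\<in>J'. - scal (c k) (b k))"
        using insert(2) by (intro sum.cong) auto
      finally have "(\<Sum>k\<in>J. scal (?c k) (b k)) \<in> I" using c cls_eq_iff by (simp add: sum_negf)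
      then have "?c j = 0" using insert(4) by (intro indep) auto
      then show False by simp
    qed
    moreover have "Q.dimension (card J') F (E J')" using insert by blast
    ultimately show ?case using insert(1,2) cls_carrier Q.Suc_dim by simp
  qed
  have "E J = cls ` homogeneous_part d"
  proof (intro equalityI subsetI)
    fix x assume "x \<in> E J"
    then show "x \<in> cls ` homogeneous_part d" unfolding E_def
      using hom by (auto intro!: imageI MP.subspace_sum MP.subspace_scale subspace_homogeneous_part)
  next
    fix x assume "x \<in> cls ` homogeneous_part d"
    then obtain f where f: "f \<in> homogeneous_part d" "x = cls f" by blast
    then show "x \<in> E J" using spanning[OF f(1)] cls_eq_iff unfolding E_def by blast
  qed
  then have "Q.dimension (card J) F (cls ` homogeneous_part d)" using dim[of J] by simp
  then show ?thesis using Q.dimI[OF F] by (simp add: hilbert_function_def F_def cls_def)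
qed

section \<open>Separating products of linear forms\<close>

lemma adapted_coordinates_exist: "P \<noteq> 0 \<Longrightarrow> \<exists>v0. adapted_coordinates P v0"
  by (auto simp: adapted_coordinates_def vec_eq_iff)

lemma one_notin_point_ideal: "P \<noteq> 0 \<Longrightarrow> 1 \<notin> point_ideal P"
proof
  assume "P \<noteq> 0" "1 \<in> point_ideal P"
  then obtain v0 where "adapted_coordinates P v0" using adapted_coordinates_exist by blast
  then interpret adapted_coordinates P v0 .
  have "mpoly_eval f P = 0" if "f \<in> vanishing 1" for f
    using that unfolding vanishing_def
    by (induction rule: MP.span_induct_alt) (auto simp: mpoly_eval_add mpoly_eval_scal eval_ymon)
  then show False using \<open>1 \<in> point_ideal P\<close> by (force simp: point_ideal_eq)
qed

text \<open>
  The monomials of degree \<open>B\<close> and order less than \<open>a\<close> at \<open>P\<close> are a basis of \<open>R\<^sub>B\<close> modulo \<open>I\<^sub>P\<^sup>a\<close>.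
\<close>

lemma (in adapted_coordinates) forms_modulo_power:
  fixes a B :: nat
  defines "T \<equiv> {t. mdeg t = B \<and> codeg v0 t < a}"
  shows "f \<in> homogeneous_part B \<Longrightarrow> \<exists>c. f - (\<Sum>t\<in>T. scal (c t) (ymon t)) \<in> point_power P a"
    and "(\<Sum>t\<in>T. scal (c t) (ymon t)) \<in> point_power P a \<Longrightarrow> t \<in> T \<Longrightarrow> c t = 0"
proof -
  define H where "H = {t. mdeg t = B \<and> a \<le> codeg v0 t}"
  have un: "exps B = T \<union> H" "T \<inter> H = {}" unfolding T_def H_def by auto
  have fin: "finite T" "finite H" using finite_exponents[of B] un(1) by (metis finite_Un)+
  have high: "(\<Sum>t\<in>H. scal (c t) (ymon t)) \<in> point_power P a" for c
    unfolding point_power_eq vanishing_def H_def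
    by (intro MP.span_sum MP.span_scale MP.span_base) auto
  {
    assume "f \<in> homogeneous_part B"
    then obtain c where c: "f = (\<Sum>t\<in>exps B. scal (c t) (ymon t))"
      using span_ymon_coeffs[OF finite_exponents[of B]] span_ymon[of B] by blast
    have "f - (\<Sum>t\<in>T. scal (c t) (ymon t)) = (\<Sum>t\<in>H. scal (c t) (ymon t))"
      unfolding c un(1) by (simp add: sum.union_disjoint[OF fin un(2)])
    then show "\<exists>c. f - (\<Sum>t\<in>T. scal (c t) (ymon t)) \<in> point_power P a" using high by metis
  }
  assume low: "(\<Sum>t\<in>T. scal (c t) (ymon t)) \<in> point_power P a" and t: "t \<in> T"
  have "(\<Sum>t\<in>T. scal (c t) (ymon t)) \<in> homogeneous_part B"
    using ymon_homogeneous
    by (intro MP.subspace_sum MP.subspace_scale subspace_homogeneous_part) (auto simp: T_def)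
  then have "(\<Sum>t\<in>T. scal (c t) (ymon t)) \<in> MP.span (ymon ` H)"
    using vanishing_homogeneous low unfolding H_def point_power_eq by blast
  then obtain e where e: "(\<Sum>t\<in>T. scal (c t) (ymon t)) = (\<Sum>t\<in>H. scal (e t) (ymon t))"
    using span_ymon_coeffs[OF fin(2)] by blast
  let ?g = "\<lambda>t. if t \<in> T then c t else - e t"
  have "(\<Sum>t\<in>exps B. scal (?g t) (ymon t)) = (\<Sum>t\<in>T. scal (?g t) (ymon t)) + (\<Sum>t\<in>H. scal (?g t) (ymon t))"
    unfolding un(1) by (rule sum.union_disjoint[OF fin un(2)])
  also have "(\<Sum>t\<in>T. scal (?g t) (ymon t)) = (\<Sum>t\<in>T. scal (c t) (ymon t))" by simp
  also have "(\<Sum>t\<in>H. scal (?g t) (ymon t)) = (\<Sum>t\<in>H. - scal (e t) (ymon t))"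
    using un(2) by (intro sum.cong) auto
  finally have "(\<Sum>t\<in>exps B. scal (?g t) (ymon t)) = 0" by (simp add: e sum_negf)
  then have "?g t = 0" by (rule ymon_coeffs_zero) (use t un(1) in blast)
  then show "c t = 0" using t by simp
qed

text \<open>
  The forms of positive degree in \<open>I\<^sub>P\<close> are sums of multiples of linear forms that vanish at \<open>P\<close>.
\<close>

lemma point_ideal_forms_subset:
  assumes "P \<noteq> 0" "MP.subspace S"
    and "\<And>c G. dotp c P = 0 \<Longrightarrow> G \<in> homogeneous_part B \<Longrightarrow> linear_form c * G \<in> S"
  shows "point_power P 1 \<inter> homogeneous_part (Suc B) \<subseteq> S"
proof -
  obtain v0 where "adapted_coordinates P v0" using adapted_coordinates_exist[OF assms(1)] by blast
  then interpret adapted_coordinates P v0 .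
  have "ymon t \<in> S" if t: "mdeg t = Suc B" "1 \<le> codeg v0 t" for t
  proof -
    have "\<exists>u\<in>UNIV - {v0}. lookup t u \<noteq> 0" using t(2) unfolding codeg_def
      by (metis not_one_le_zero sum.neutral)
    then obtain u where u: "u \<noteq> v0" "lookup t u \<noteq> 0" by blast
    from exponent_remove[OF u(2)] obtain t' where t': "t = single u 1 + t'" by blast
    then have "mdeg t' = B" using t(1) by (simp add: mdeg_add)
    then have "linear_form (yvec u) * ymon t' \<in> S"
      using ymon_homogeneous[of t'] u(1) by (intro assms(3)) (auto simp: dotp_yvec)
    then show ?thesis by (simp add: t' ymon_add ymon_single[unfolded One_nat_def])
  qed
  then have "MP.span (ymon ` {t. mdeg t = Suc B \<and> 1 \<le> codeg v0 t}) \<subseteq> S"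
    by (intro MP.span_minimal assms(2)) auto
  then show ?thesis using vanishing_homogeneous unfolding point_power_eq by blast
qed

lemma forms_subset:
  assumes "MP.subspace S"
    and "\<And>c G. G \<in> homogeneous_part B \<Longrightarrow> linear_form c * G \<in> S"
  shows "homogeneous_part (Suc B) \<subseteq> (S :: ('v::finite, 'k::field) mpoly set)"
proof
  fix f :: "('v, 'k) mpoly" assume f: "f \<in> homogeneous_part (Suc B)"
  have "single t (1::'k) \<in> S" if "t \<in> keys f" for t
  proof -
    have t: "mdeg t = Suc B" using f that by (simp add: homogeneous_part_iff in_keys_iff)
    then have "\<exists>u. lookup t u \<noteq> 0" by (metis mdeg_def nat.distinct(1) sum.neutral)
    then obtain u where "lookup t u \<noteq> 0" by blast
    from exponent_remove[OF this] obtain t' where t': "t = single u 1 + t'" by blast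
    then have "mdeg t' = B" using t by (simp add: mdeg_add)
    then have "linear_form (axis u 1) * single t' 1 \<in> S" using homogeneous_part_single by (intro assms(2)) blast
    then show ?thesis by (simp add: linear_form_axis mult_single t')
  qed
  then have "(\<Sum>t\<in>keys f. scal (lookup f t) (single t 1)) \<in> S"
    by (intro MP.subspace_sum MP.subspace_scale assms(1)) auto
  then show "f \<in> S" by (simp flip: sum_monomials)
qed

lemma subspace_colon:
  assumes "MP.subspace S"
  shows "MP.subspace {G. F * G \<in> S}"
  using assms unfolding MP.subspace_def by (auto simp: distrib_left scal_mult_right)

lemma linear_form_zero [simp]: "linear_form 0 = 0"
  by (simp add: linear_form_def)

lemma subspace_annihilated_forms:
  assumes "MP.subspace S"
  shows "vec.subspace {c. dotp c P = 0 \<and> (\<forall>G\<in>H. linear_form c * G \<in> S)}"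
  using assms
  by (auto simp: vec.subspace_def MP.subspace_def linear_form_add linear_form_scale dotp_add_left dotp_scale_left
      distrib_right scal_mult_left)

text \<open>
  The heart of the argument, by induction on \<open>B\<close>. Here \<open>i + 1\<close> is the multiplicity of \<open>P\<close>, and each label
  \<open>e\<close> asks for one factor that vanishes at \<open>q e\<close>. A factor vanishes on an independent set \<open>T\<close> of labels,
  whose vectors are different, and so it raises the order of the product at each of these vectors by one. The
  two cases of the proof are those of the introduction: either every form \<open>c\<close> in the orthogonal complement of
  \<open>P\<close> satisfies \<open>c R\<^sub>B \<subseteq> S\<close>, or those that do vanish at a further vector \<open>w\<close>.
\<close>

theorem separating_product:
  fixes P :: "'k::field ^ 'v::finite" and q :: "'e \<Rightarrow> 'k ^ 'v" and S :: "('v, 'k) mpoly set"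
  assumes "P \<noteq> 0" "finite E" "MP.subspace S"
    and "\<And>A. A \<subseteq> E \<Longrightarrow> A \<noteq> {} \<Longrightarrow> int (card A) + int i \<le> int B * contraction_rank {P} q A"
    and "point_power P (Suc i) \<inter> homogeneous_part B \<subseteq> S"
    and "\<not> homogeneous_part B \<subseteq> S"
  shows "\<exists>F\<in>homogeneous_part B. F \<notin> S \<and> (\<forall>Q. F \<in> point_power Q (card {e\<in>E. q e = Q}))"
  using assms(2-)
proof (induction B arbitrary: E i S)
  case 0
  have "E = {}"
  proof (rule ccontr)
    assume "E \<noteq> {}"
    then have "int (card E) \<le> 0" using 0(3)[of E] by simp
    then show False using 0(1) \<open>E \<noteq> {}\<close> by simp
  qed
  have "1 \<notin> S"
  proof
    assume 1: "1 \<in> S"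
    have "f \<in> S" if "f \<in> homogeneous_part 0" for f
    proof -
      have "keys f \<subseteq> {0}"
        using that by (auto simp: homogeneous_part_iff in_keys_iff mdeg_def intro!: poly_mapping_eqI)
      then have "f = scal (lookup f 0) 1" using sum_monomials[of "{0}" f] by simp
      then show ?thesis using MP.subspace_scale[OF 0(2) 1] by metis
    qed
    then show False using 0(5) by blast
  qed
  then show ?case using \<open>E = {}\<close> by (intro bexI[of _ 1]) (auto simp: point_power_0)
next
  case (Suc B)
  note fin = Suc(2) and S = Suc(3) and dense = Suc(4) and sub = Suc(5) and proper = Suc(6)
  \<comment> \<open>Once \<open>T\<close> and a linear form \<open>c\<close> that vanishes on it are chosen, the colon space \<open>S : c\<close> takes the place of \<open>S\<close>.\<close>
  have step: ?case
    if T: "T \<subseteq> E" "inj_on q T" and c: "\<And>e. e \<in> T \<Longrightarrow> dotp c (q e) = 0"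
      and G: "G \<in> homogeneous_part B" "linear_form c * G \<notin> S"
      and sub': "point_power P (Suc i') \<inter> homogeneous_part B \<subseteq> {G. linear_form c * G \<in> S}"
      and dense': "\<forall>A\<subseteq>E - T. A \<noteq> {} \<longrightarrow> int (card A) + int i' \<le> int B * contraction_rank {P} q A"
    for T c G i'
  proof -
    have "\<exists>F\<in>homogeneous_part B. F \<notin> {G. linear_form c * G \<in> S} \<and>
        (\<forall>Q. F \<in> point_power Q (card {e \<in> E - T. q e = Q}))"
      using fin G dense' by (intro Suc(1)[where i = i'] subspace_colon S sub') auto
    then obtain F where F: "F \<in> homogeneous_part B" "linear_form c * F \<notin> S"
      "\<And>Q. F \<in> point_power Q (card {e \<in> E - T. q e = Q})" by blast
    have "linear_form c * F \<in> point_power Q (card {e \<in> E. q e = Q})" for Q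
    proof (cases "Q \<in> q ` T")
      case True
      then obtain e where e: "e \<in> T" "Q = q e" by blast
      have "{e' \<in> E. q e' = Q} \<subseteq> insert e {e \<in> E - T. q e = Q}"
        using e T inj_onD[OF T(2)] by blast
      then have "card {e' \<in> E. q e' = Q} \<le> card (insert e {e \<in> E - T. q e = Q})"
        using fin by (intro card_mono) auto
      also have "\<dots> \<le> Suc (card {e \<in> E - T. q e = Q})" by (rule card_insert_le_m1) auto
      finally have "card {e' \<in> E. q e' = Q} \<le> Suc (card {e \<in> E - T. q e = Q})" .
      moreover have "linear_form c * F \<in> point_power Q (Suc (card {e \<in> E - T. q e = Q}))"
        using c[OF e(1)] e(2) F(3) by (intro linear_form_mult_point_power) auto
      ultimately show ?thesis using point_power_antimono by blast
    next
      case False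
      then have "{e \<in> E. q e = Q} = {e \<in> E - T. q e = Q}" by blast
      then show ?thesis using F(3) by (simp add: point_power_mult)
    qed
    moreover have "linear_form c * F \<in> homogeneous_part (Suc B)"
      using homogeneous_part_mult[OF linear_form_homogeneous[of c] F(1)] by simp
    ultimately show ?thesis using F(2) by blast
  qed
  have fin_sub: "finite A" if "A \<subseteq> E" for A using fin that finite_subset by blast
  have dense': "int (card A) + int i \<le> (int B + 1) * contraction_rank {P} q A" if "A \<subseteq> E" "A \<noteq> {}" for A
    using dense[OF that] by (simp add: add.commute)
  have rank: "rank_function E (contraction_rank C q)" for C by (rule rank_function_contraction[OF fin])
  have ind_P: "vec.independent {P}" using assms(1) by simp
  show ?case
  proof (cases "\<forall>c. dotp c P = 0 \<longrightarrow> (\<forall>G\<in>homogeneous_part B. linear_form c * G \<in> S)")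
    case True
    \<comment> \<open>\<open>S\<close> contains all of \<open>I\<^sub>P\<close> in this degree, so multiplicity one may be assumed, that is, \<open>i = 0\<close>.\<close>
    have sub1: "point_power P 1 \<inter> homogeneous_part (Suc B) \<subseteq> S"
      using True by (intro point_ideal_forms_subset assms(1) S) auto
    have "\<exists>T\<subseteq>E. contraction_rank {P} q T = int (card T) \<and>
        (\<forall>A\<subseteq>E - T. A \<noteq> {} \<longrightarrow> int (card A) + int (0 - 1) \<le> int B * contraction_rank {P} q A)"
    proof (rule peel_independent_set[OF rank rank])
      fix A assume "A \<subseteq> E" "A \<noteq> {}"
      then show "int (card A) + int 0 \<le> (int B + 1) * contraction_rank {P} q A" using dense'[of A] by linarith
    qed auto
    then obtain T where T: "T \<subseteq> E" "contraction_rank {P} q T = int (card T)"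
      "\<forall>A\<subseteq>E - T. A \<noteq> {} \<longrightarrow> int (card A) + int 0 \<le> int B * contraction_rank {P} q A" by auto
    note ind = contraction_independent[OF fin_sub[OF T(1)] T(2) ind_P]
    have "P \<notin> vec.span (q ` T)" using ind(2)[of P] by simp
    then obtain c where c: "\<And>x. x \<in> q ` T \<Longrightarrow> dotp c x = 0" "dotp c P \<noteq> 0" using separating_form by blast
    have "\<exists>G\<in>homogeneous_part B. linear_form c * G \<notin> S"
    proof (rule ccontr)
      assume "\<not> (\<exists>G\<in>homogeneous_part B. linear_form c * G \<notin> S)"
      then have lc: "\<And>G. G \<in> homogeneous_part B \<Longrightarrow> linear_form c * G \<in> S" by blast
      have "linear_form d * G \<in> S" if G: "G \<in> homogeneous_part B" for d G
      proof -
        \<comment> \<open>Every linear form is a multiple of \<open>c\<close> plus a form that vanishes at \<open>P\<close>.\<close>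
        let ?r = "dotp d P / dotp c P"
        let ?d = "d + (- ?r) *s c"
        have "dotp ?d P = 0" unfolding dotp_add_left dotp_scale_left using c(2) by simp
        then have "linear_form ?d * G \<in> S" using True G by blast
        then have "linear_form ?d * G + scal ?r (linear_form c * G) \<in> S"
          using lc[OF G] by (intro MP.subspace_add[OF S] MP.subspace_scale[OF S])
        moreover have "linear_form ?d * G + scal ?r (linear_form c * G) = linear_form (?d + ?r *s c) * G"
          unfolding linear_form_add[of ?d] linear_form_scale by (simp only: distrib_right scal_mult_left)
        moreover have "?d + ?r *s c = d" by (simp add: vec_eq_iff)
        ultimately show ?thesis by simp
      qed
      then show False using forms_subset[OF S] proper by blast
    qed
    then obtain G where G: "G \<in> homogeneous_part B" "linear_form c * G \<notin> S" by blast
    have "point_power P (Suc 0) \<inter> homogeneous_part B \<subseteq> {G. linear_form c * G \<in> S}"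
    proof
      fix G assume "G \<in> point_power P (Suc 0) \<inter> homogeneous_part B"
      then have "linear_form c * G \<in> point_power P 1 \<inter> homogeneous_part (Suc B)"
        using homogeneous_part_mult[OF linear_form_homogeneous[of c]] by (auto simp: point_power_mult)
      then show "G \<in> {G. linear_form c * G \<in> S}" using sub1 by blast
    qed
    then show ?thesis using c(1) by (intro step[OF T(1) ind(1) _ G _ T(3)]) auto
  next
    case False
    define N where "N = {c. dotp c P = 0 \<and> (\<forall>G\<in>homogeneous_part B. linear_form c * G \<in> S)}"
    obtain c0 where c0: "dotp c0 P = 0" "c0 \<notin> N" using False unfolding N_def by blast
    have in_power: "linear_form c * G \<in> point_power P (Suc j) \<inter> homogeneous_part (Suc B)"
      if "dotp c P = 0" "G \<in> point_power P j" "G \<in> homogeneous_part B" for c G j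
      using linear_form_mult_point_power[OF that(1,2)] homogeneous_part_mult[OF linear_form_homogeneous[of c] that(3)]
      by simp
    \<comment> \<open>For \<open>i = 0\<close> all multiples of forms that vanish at \<open>P\<close> lie in \<open>S\<close>, which is the previous case.\<close>
    have "i \<noteq> 0"
    proof
      assume "i = 0"
      then have "linear_form c0 * G \<in> S" if "G \<in> homogeneous_part B" for G
        using in_power[OF c0(1), of G 0] sub that by (auto simp: point_power_0)
      then show False using c0 unfolding N_def by blast
    qed
    then obtain i' where i: "i = Suc i'" using not0_implies_Suc by blast
    have span_N: "vec.span N = N"
      unfolding N_def vec.span_eq_iff by (rule subspace_annihilated_forms[OF S])
    have "c0 \<notin> vec.span N" unfolding span_N by (rule c0(2))
    then obtain w where w: "\<And>c. c \<in> N \<Longrightarrow> dotp w c = 0" "dotp w c0 \<noteq> 0" using separating_form by blast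
    have w_P: "w \<notin> vec.span {P}"
      using w(2) c0(1) by (auto simp: vec.span_singleton dotp_sym[of _ c0] dotp_scale_right)
    then have ind_Pw: "vec.independent {w, P}" by (rule vec.independent_insertI[OF _ ind_P])
    have "w \<noteq> P" using w_P vec.span_base[of P "{P}"] by blast
    have dims: "vec.dim {P} = 1" "vec.dim {w, P} = 2"
      using vec.dim_eq_card_independent[OF ind_P] vec.dim_eq_card_independent[OF ind_Pw] \<open>w \<noteq> P\<close> by auto
    have rk: "contraction_rank {w, P} q A = contraction_rank {P} q A - (if w \<in> vec.span (insert P (q ` A)) then 1 else 0)"
      for A
    proof -
      have "{w, P} \<union> q ` A = insert w (insert P (q ` A))" "{P} \<union> q ` A = insert P (q ` A)" by auto
      then show ?thesis unfolding contraction_rank_def dims by (simp add: vec.dim_insert[of w "insert P (q ` A)"])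
    qed
    have "\<exists>T\<subseteq>E. contraction_rank {w, P} q T = int (card T) \<and>
        (\<forall>A\<subseteq>E - T. A \<noteq> {} \<longrightarrow> int (card A) + int (i - 1) \<le> int B * contraction_rank {P} q A)"
      using dense' \<open>i \<noteq> 0\<close> by (intro peel_independent_set[OF rank rank]) (auto simp: rk)
    then obtain T where T: "T \<subseteq> E" "contraction_rank {w, P} q T = int (card T)"
      "\<forall>A\<subseteq>E - T. A \<noteq> {} \<longrightarrow> int (card A) + int i' \<le> int B * contraction_rank {P} q A" by (auto simp: i)
    note ind = contraction_independent[OF fin_sub[OF T(1)] T(2) ind_Pw]
    have "w \<notin> vec.span (insert P (q ` T))" using ind(2)[of w] \<open>w \<noteq> P\<close> by (simp add: insert_Diff_if)
    then obtain c where c: "\<And>x. x \<in> insert P (q ` T) \<Longrightarrow> dotp c x = 0" "dotp c w \<noteq> 0"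
      using separating_form by blast
    have "c \<notin> N" using w(1)[of c] c(2) by (auto simp: dotp_sym)
    then obtain G where G: "G \<in> homogeneous_part B" "linear_form c * G \<notin> S" using c(1) unfolding N_def by blast
    have "point_power P (Suc i') \<inter> homogeneous_part B \<subseteq> {G. linear_form c * G \<in> S}"
      using in_power[of c _ "Suc i'"] sub c(1) i by blast
    then show ?thesis using c(1) by (intro step[OF T(1) ind(1) _ G _ T(3)]) auto
  qed
qed

section \<open>The Segre bound\<close>

text \<open>
  The inequality \<open>(w\<^sub>L - 1) / dim L \<le> B\<close> without division; \<open>L\<close> is a cone, so its vector space dimension is
  one more than the projective dimension.
\<close>

definition segre_condition :: "nat \<Rightarrow> (nat \<Rightarrow> 'k::field ^ 'v::finite) \<Rightarrow> (nat \<Rightarrow> nat) \<Rightarrow> nat \<Rightarrow> bool" where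
  "segre_condition s P m B \<longleftrightarrow>
     (\<forall>L. vec.subspace L \<and> vec.dim L \<ge> 2 \<longrightarrow> int (weight L s P m) - 1 \<le> int B * (int (vec.dim L) - 1))"

lemma contraction_rank_singleton:
  "P \<noteq> 0 \<Longrightarrow> contraction_rank {P} q A = int (vec.dim (vec.span (insert P (q ` A)))) - 1"
  using vec.dim_eq_card_independent[of "{P}"] by (simp add: contraction_rank_def vec.dim_span)

lemma dim_ge_2:
  assumes "P \<noteq> 0" "Q \<noteq> 0" "\<not> same_point P Q" "P \<in> L" "Q \<in> L"
  shows "2 \<le> vec.dim L"
proof -
  have "Q \<notin> vec.span {P}"
    using assms(2,3) by (auto simp: same_point_def vec.span_singleton)
  then have "vec.independent {Q, P}" by (rule vec.independent_insertI) (use assms(1) in simp)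
  moreover have "Q \<noteq> P" using \<open>Q \<notin> vec.span {P}\<close> vec.span_base[of P "{P}"] by blast
  ultimately have "vec.dim {Q, P} = 2" using vec.dim_eq_card_independent[of "{Q, P}"] by simp
  then show ?thesis using vec.dim_subset[of "{Q, P}" L] assms by simp
qed

context
  fixes P :: "nat \<Rightarrow> 'k::field ^ 'v::finite" and m :: "nat \<Rightarrow> nat" and s B :: nat
  assumes scheme: "fat_point_scheme s P m" and segre: "segre_condition s P m B"
begin

lemma points_nonzero: "i \<in> {1..s} \<Longrightarrow> P i \<noteq> 0" and multiplicity_pos: "i \<in> {1..s} \<Longrightarrow> 1 \<le> m i"
  and points_distinct: "i \<in> {1..s} \<Longrightarrow> j \<in> {1..s} \<Longrightarrow> i \<noteq> j \<Longrightarrow> \<not> same_point (P i) (P j)"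
  using scheme unfolding fat_point_scheme_def by blast+

definition other_points :: "nat \<Rightarrow> ('v, 'k) mpoly set" where
  "other_points i = (\<Inter>j\<in>{1..s} - {i}. point_power (P j) (m j))"

text \<open>
  The Segre inequality for the linear span of \<open>P\<^sub>i\<close> and of the points that occur in \<open>A\<close>. Its weight counts \<open>m\<^sub>i\<close>
  in addition to the elements of \<open>A\<close>, and its projective dimension is the rank of \<open>A\<close> modulo \<open>P\<^sub>i\<close>.
\<close>

lemma labels_dense:
  assumes i: "i \<in> {1..s}" and A: "A \<subseteq> (SIGMA j:{1..s} - {i}. {..<m j})" "A \<noteq> {}"
  shows "int (card A) + int (m i - 1) \<le> int B * contraction_rank {P i} (\<lambda>(j, k). P j) A"
proof -
  let ?q = "\<lambda>(j, k :: nat). P j"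
  define L where "L = vec.span (insert (P i) (?q ` A))"
  obtain j k where jk: "(j, k) \<in> A" using A(2) by auto
  then have j: "j \<in> {1..s}" "i \<noteq> j" using A(1) by auto
  have in_L: "P j \<in> L" if "(j, k) \<in> A" for j k
    using that unfolding L_def by (intro vec.span_base) force
  have Pi: "P i \<in> L" unfolding L_def by (intro vec.span_base) simp
  have "2 \<le> vec.dim L"
    using i j in_L[OF jk] Pi points_nonzero points_distinct by (intro dim_ge_2[of "P i" "P j"]) auto
  then have "int (weight L s P m) - 1 \<le> int B * (int (vec.dim L) - 1)"
    using segre unfolding segre_condition_def L_def by blast
  moreover have "card A + m i \<le> weight L s P m"
  proof -
    let ?J = "{j \<in> {1..s}. P j \<in> L} - {i}"
    have "A \<subseteq> (SIGMA j:?J. {..<m j})" using A(1) in_L by auto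
    then have "card A \<le> card (SIGMA j:?J. {..<m j})" by (intro card_mono) auto
    also have "\<dots> = (\<Sum>j\<in>?J. m j)" by simp
    finally have "card A + m i \<le> (\<Sum>j\<in>?J. m j) + m i" by simp
    also have "\<dots> = weight L s P m"
      unfolding weight_def using i Pi by (subst (2) sum.remove[of _ i]) auto
    finally show ?thesis .
  qed
  moreover have "contraction_rank {P i} ?q A = int (vec.dim L) - 1"
    unfolding L_def by (rule contraction_rank_singleton[OF points_nonzero[OF i]])
  ultimately show ?thesis using multiplicity_pos[OF i] by simp
qed

lemma subspace_other_points: "MP.subspace (other_points i)"
  unfolding other_points_def by (intro MP.subspace_Inter ballI) (auto intro: ideal_subspace ideal_point_power)

text \<open>
  \<open>I\<^sub>P\<^sup>m\<close> and the ideal of the other fat points together span \<open>R\<^sub>B\<close>: a product that separates \<open>P\<^sub>i\<close> from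
  their sum \<open>S\<close> would itself lie in the ideal of the other points, hence in \<open>S\<close>.
\<close>

lemma split_form:
  assumes i: "i \<in> {1..s}" and f: "f \<in> homogeneous_part B"
  shows "\<exists>g \<in> other_points i \<inter> homogeneous_part B. f - g \<in> point_power (P i) (m i)"
proof -
  define C where "C = other_points i \<inter> homogeneous_part B"
  define S where "S = {x + y | x y. x \<in> point_power (P i) (m i) \<and> y \<in> C}"
  have C: "MP.subspace C"
    unfolding C_def by (intro MP.subspace_inter subspace_other_points subspace_homogeneous_part)
  have I: "MP.subspace (point_power (P i) (m i))" by (intro ideal_subspace ideal_point_power)
  have S: "MP.subspace S" unfolding S_def by (rule MP.subspace_sums[OF I C])
  have S_power: "point_power (P i) (m i) \<subseteq> S" unfolding S_def using MP.subspace_0[OF C] by force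
  have S_C: "C \<subseteq> S" unfolding S_def using MP.subspace_0[OF I] by force
  have "homogeneous_part B \<subseteq> S"
  proof (rule ccontr)
    assume not: "\<not> homogeneous_part B \<subseteq> S"
    let ?E = "SIGMA j:{1..s} - {i}. {..<m j}"
    have "\<exists>F\<in>homogeneous_part B. F \<notin> S \<and> (\<forall>Q. F \<in> point_power Q (card {e\<in>?E. (\<lambda>(j, k). P j) e = Q}))"
      using S_power multiplicity_pos[OF i]
      by (intro separating_product[OF points_nonzero[OF i] _ S labels_dense[OF i] _ not]) auto
    then obtain F where F: "F \<in> homogeneous_part B" "F \<notin> S"
      "\<And>Q. F \<in> point_power Q (card {e\<in>?E. (\<lambda>(j, k). P j) e = Q})" by blast
    have "F \<in> point_power (P j) (m j)" if j: "j \<in> {1..s} - {i}" for j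
    proof -
      have "Pair j ` {..<m j} \<subseteq> {e\<in>?E. (\<lambda>(j, k). P j) e = P j}" using j by auto
      then have "card (Pair j ` {..<m j}) \<le> card {e\<in>?E. (\<lambda>(j, k). P j) e = P j}"
        by (intro card_mono) auto
      then have "m j \<le> card {e\<in>?E. (\<lambda>(j, k). P j) e = P j}" by (simp add: card_image inj_on_def)
      then show ?thesis using point_power_antimono F(3) by blast
    qed
    then have "F \<in> C" using F(1) unfolding C_def other_points_def by blast
    then show False using S_C F(2) by blast
  qed
  then obtain x y where xy: "f = x + y" "x \<in> point_power (P i) (m i)" "y \<in> C" using f unfolding S_def by blast
  then show ?thesis unfolding C_def by (intro bexI[of _ y]) auto
qed

text \<open>
  The Segre inequality for a line through the point.
\<close>

lemma multiplicity_le: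
  assumes "CARD('v) \<ge> 2" "i \<in> {1..s}"
  shows "m i \<le> Suc B"
proof -
  have "vec.dim {P i} \<noteq> vec.dim (UNIV :: ('k ^ 'v) set)"
    using assms(1) points_nonzero[OF assms(2)] vec.dim_eq_card_independent[of "{P i}"] by (simp add: vec.dim_UNIV card_cart_basis)
  then have "vec.span {P i} \<noteq> UNIV" by (metis vec.dim_span)
  then obtain u where u: "u \<notin> vec.span {P i}" by blast
  have P0: "P i \<noteq> 0" by (rule points_nonzero[OF assms(2)])
  have "vec.independent {u, P i}" using u by (rule vec.independent_insertI) (use P0 in simp)
  moreover have "u \<noteq> P i" using u vec.span_base[of "P i" "{P i}"] by blast
  ultimately have dim: "vec.dim (vec.span {u, P i}) = 2"
    using vec.dim_eq_card_independent[of "{u, P i}"] by (simp add: vec.dim_span)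
  have "int (weight (vec.span {u, P i}) s P m) - 1 \<le> int B * (int (vec.dim (vec.span {u, P i})) - 1)"
    using segre[unfolded segre_condition_def, THEN spec, of "vec.span {u, P i}"] unfolding dim
    by (simp del: vec.dim_span)
  then have "int (weight (vec.span {u, P i}) s P m) - 1 \<le> int B" unfolding dim by simp
  moreover have "m i \<le> weight (vec.span {u, P i}) s P m"
    unfolding weight_def using assms(2) vec.span_base[of "P i" "{u, P i}"] by (intro member_le_sum) auto
  ultimately show ?thesis by linarith
qed

text \<open>
  The Chinese remainder principle: a basis modulo each \<open>I\<^sub>P\<^sup>m\<close> is lifted, by \<open>split_form\<close>, to forms \<open>b\<close> that
  vanish to the required order at all other points. Modulo \<open>I\<^sub>P\<^sup>m\<close> a combination of all lifts reduces to its
  part at \<open>P\<close> (\<open>combine\<close>), so the lifts are a basis modulo the intersection.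
\<close>

theorem hilbert_function_fat_ideal:
  assumes card: "CARD('v) \<ge> 2"
  shows "hilbert_function (fat_ideal s P m) B = fat_degree (CARD('v) - 1) s m"
proof -
  have "\<forall>i\<in>{1..s}. \<exists>v0. adapted_coordinates (P i) v0"
    using points_nonzero adapted_coordinates_exist by blast
  then obtain v where v: "\<And>i. i \<in> {1..s} \<Longrightarrow> adapted_coordinates (P i) (v i)" by metis
  define T where "T i = {t. mdeg t = B \<and> codeg (v i) t < m i}" for i
  define y where "y i = adapted_coordinates.ymon (P i) (v i)" for i
  have y_hom: "y i t \<in> homogeneous_part B" if "i \<in> {1..s}" "t \<in> T i" for i t
    using adapted_coordinates.ymon_homogeneous[OF v[OF that(1)], of t] that(2) by (simp add: y_def T_def)
  have "\<forall>i\<in>{1..s}. \<forall>t\<in>T i. \<exists>g. g \<in> other_points i \<inter> homogeneous_part B \<and> y i t - g \<in> point_power (P i) (m i)"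
    using split_form y_hom by blast
  then obtain b where b: "\<And>i t. i \<in> {1..s} \<Longrightarrow> t \<in> T i \<Longrightarrow> b i t \<in> other_points i \<inter> homogeneous_part B"
    "\<And>i t. i \<in> {1..s} \<Longrightarrow> t \<in> T i \<Longrightarrow> y i t - b i t \<in> point_power (P i) (m i)" by metis
  have T_fin: "finite (T i)" for i
    unfolding T_def by (rule finite_subset[OF _ finite_exponents[of B]]) auto
  let ?J = "SIGMA i:{1..s}. T i"
  have sub: "MP.subspace (point_power Q a)" for Q :: "'k ^ 'v" and a by (intro ideal_subspace ideal_point_power)
  have fat: "fat_ideal s P m = (\<Inter>i\<in>{1..s}. point_power (P i) (m i))"
    by (simp add: fat_ideal_def point_power_def)
  have combine: "(\<Sum>(j, t)\<in>?J. scal (c (j, t)) (b j t)) - (\<Sum>t\<in>T i. scal (c (i, t)) (y i t)) \<in> point_power (P i) (m i)"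
    if i: "i \<in> {1..s}" for c i
  proof -
    have "(\<Sum>(j, t)\<in>?J. scal (c (j, t)) (b j t)) = (\<Sum>j\<in>{1..s}. \<Sum>t\<in>T j. scal (c (j, t)) (b j t))"
      using T_fin by (subst sum.Sigma) auto
    also have "\<dots> = (\<Sum>t\<in>T i. scal (c (i, t)) (b i t)) + (\<Sum>j\<in>{1..s} - {i}. \<Sum>t\<in>T j. scal (c (j, t)) (b j t))"
      using i by (subst sum.remove[of _ i]) auto
    finally have "(\<Sum>(j, t)\<in>?J. scal (c (j, t)) (b j t)) - (\<Sum>t\<in>T i. scal (c (i, t)) (y i t)) =
        (\<Sum>j\<in>{1..s} - {i}. \<Sum>t\<in>T j. scal (c (j, t)) (b j t)) - (\<Sum>t\<in>T i. scal (c (i, t)) (y i t - b i t))"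
      by (simp add: MP.scale_right_diff_distrib sum_subtractf)
    also have "\<dots> \<in> point_power (P i) (m i)"
    proof (rule MP.subspace_diff[OF sub])
      show "(\<Sum>j\<in>{1..s} - {i}. \<Sum>t\<in>T j. scal (c (j, t)) (b j t)) \<in> point_power (P i) (m i)"
        using b(1) i by (intro MP.subspace_sum MP.subspace_scale sub) (auto simp: other_points_def)
      show "(\<Sum>t\<in>T i. scal (c (i, t)) (y i t - b i t)) \<in> point_power (P i) (m i)"
        using b(2)[OF i] by (intro MP.subspace_sum MP.subspace_scale sub)
    qed
    finally show ?thesis .
  qed
  have "hilbert_function (fat_ideal s P m) B = card ?J"
  proof (rule hilbert_function_eq_card)
    show "finite ?J" using T_fin by (intro finite_SigmaI) auto
    show "ideal (fat_ideal s P m) coord_ring"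
      using ideal_point_power[of "P _" "m _", unfolded ideal_coord_ring_iff]
      unfolding fat ideal_coord_ring_iff by simp
    have "1 \<in> {1..s}" using scheme unfolding fat_point_scheme_def by simp
    then have "fat_ideal s P m \<subseteq> point_power (P 1) 1"
      using point_power_antimono[OF multiplicity_pos] unfolding fat by blast
    moreover have "point_power (P 1) 1 \<subseteq> point_ideal (P 1)"
      using CR.ideal_prod_inter[OF ideal_point_power ideal_point_ideal, of "P 1" 0 "P 1"]
      by (simp add: point_power_Suc)
    ultimately show "1 \<notin> fat_ideal s P m"
      using one_notin_point_ideal points_nonzero[OF \<open>1 \<in> {1..s}\<close>] by blast
    show "(\<lambda>(i, t). b i t) k \<in> homogeneous_part B" if "k \<in> ?J" for k
      using that b(1) by auto
  next
    fix c k assume c: "(\<Sum>k\<in>?J. scal (c k) ((\<lambda>(i, t). b i t) k)) \<in> fat_ideal s P m" and "k \<in> ?J"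
    then obtain i t where k: "k = (i, t)" and i: "i \<in> {1..s}" and t: "t \<in> T i" by blast
    have "(\<Sum>(j, t)\<in>?J. scal (c (j, t)) (b j t)) \<in> point_power (P i) (m i)"
      using c i by (auto simp: fat case_prod_unfold)
    from MP.subspace_diff[OF sub this combine[OF i, of c]]
    have "(\<Sum>t\<in>T i. scal (c (i, t)) (y i t)) \<in> point_power (P i) (m i)" by simp
    then show "c k = 0"
      using adapted_coordinates.forms_modulo_power(2)[OF v[OF i], of "\<lambda>t. c (i, t)" B "m i" t] t
      by (simp add: k T_def y_def)
  next
    fix f :: "('v, 'k) mpoly" assume f: "f \<in> homogeneous_part B"
    have "\<forall>i\<in>{1..s}. \<exists>c. f - (\<Sum>t\<in>T i. scal (c t) (y i t)) \<in> point_power (P i) (m i)"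
      using adapted_coordinates.forms_modulo_power(1)[OF v f] by (simp add: T_def y_def)
    then obtain c where c: "\<And>i. i \<in> {1..s} \<Longrightarrow> f - (\<Sum>t\<in>T i. scal (c i t) (y i t)) \<in> point_power (P i) (m i)"
      by metis
    let ?c = "\<lambda>(i, t). c i t"
    have "f - (\<Sum>(j, t)\<in>?J. scal (?c (j, t)) (b j t)) \<in> point_power (P i) (m i)" if i: "i \<in> {1..s}" for i
      using MP.subspace_diff[OF sub c[OF i] combine[OF i, of ?c]] by simp
    then have "f - (\<Sum>k\<in>?J. scal (?c k) ((\<lambda>(i, t). b i t) k)) \<in> fat_ideal s P m"
      by (auto simp: fat case_prod_unfold)
    then show "\<exists>c. f - (\<Sum>k\<in>?J. scal (c k) ((\<lambda>(i, t). b i t) k)) \<in> fat_ideal s P m" by blast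
  qed
  also have "card ?J = (\<Sum>i\<in>{1..s}. card (T i))" using T_fin by (intro card_SigmaI) auto
  also have "\<dots> = fat_degree (CARD('v) - 1) s m"
    unfolding fat_degree_def T_def using multiplicity_pos multiplicity_le[OF card]
    by (intro sum.cong card_exponents_low_codeg) auto
  finally show ?thesis .
qed

end

text \<open>
  The maximum runs over a finite set, because weights and dimensions are bounded. It is nonnegative since
  the whole space has positive weight.
\<close>

lemma segre_bound_properties:
  fixes P :: "nat \<Rightarrow> 'k::field ^ 'v::finite"
  assumes "CARD('v) \<ge> 2" "fat_point_scheme s P m"
  shows "0 \<le> segre_bound s P m" "segre_condition s P m (nat (segre_bound s P m))"
proof -
  define val where "val L = \<lceil>(real (weight L s P m) - 1) / (real (vec.dim L) - 1)\<rceil>" for L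
  define V where "V = {val L | L. vec.subspace L \<and> vec.dim L \<ge> 2}"
  have "V \<subseteq> (\<lambda>(w, d). \<lceil>(real w - 1) / (real d - 1)\<rceil>) ` ({..sum m {1..s}} \<times> {..vec.dim (UNIV :: ('k ^ 'v) set)})"
  proof
    fix x assume "x \<in> V"
    then obtain L where L: "x = val L" unfolding V_def by blast
    have "weight L s P m \<le> sum m {1..s}" unfolding weight_def by (intro sum_mono2) auto
    moreover have "vec.dim L \<le> vec.dim (UNIV :: ('k ^ 'v) set)" by (intro vec.dim_subset) simp
    ultimately show "x \<in> (\<lambda>(w, d). \<lceil>(real w - 1) / (real d - 1)\<rceil>) ` ({..sum m {1..s}} \<times> {..vec.dim (UNIV :: ('k ^ 'v) set)})"
      unfolding L val_def by (intro image_eqI[of _ _ "(weight L s P m, vec.dim L)"]) auto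
  qed
  then have fin: "finite V" by (rule finite_subset) auto
  have bound: "segre_bound s P m = Max V" unfolding segre_bound_def V_def val_def by simp
  have le: "val L \<le> segre_bound s P m" if "vec.subspace L" "vec.dim L \<ge> 2" for L
    unfolding bound using that by (intro Max_ge fin) (auto simp: V_def)
  have "val UNIV \<le> segre_bound s P m" using assms(1) by (intro le) (auto simp: vec.dim_UNIV card_cart_basis)
  moreover have "0 \<le> val UNIV"
  proof -
    have "1 \<le> m 1" "1 \<in> {1..s}" using assms(2) unfolding fat_point_scheme_def by auto
    moreover have "weight UNIV s P m = sum m {1..s}" unfolding weight_def by (intro sum.cong) auto
    ultimately have "1 \<le> weight UNIV s P m" using member_le_sum[of 1 "{1..s}" m] by simp
    then have "0 \<le> (real (weight UNIV s P m) - 1) / (real (vec.dim (UNIV :: ('k ^ 'v) set)) - 1)"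
      using assms(1) by (intro divide_nonneg_nonneg) (auto simp: vec.dim_UNIV card_cart_basis)
    then show ?thesis unfolding val_def by linarith
  qed
  ultimately show nonneg: "0 \<le> segre_bound s P m" by simp
  show "segre_condition s P m (nat (segre_bound s P m))"
    unfolding segre_condition_def
  proof (intro allI impI)
    fix L :: "('k ^ 'v) set" assume L: "vec.subspace L \<and> 2 \<le> vec.dim L"
    have "(real (weight L s P m) - 1) / (real (vec.dim L) - 1) \<le> real_of_int (segre_bound s P m)"
      using le[of L] L unfolding val_def by (simp add: ceiling_le_iff)
    then have "real (weight L s P m) - 1 \<le> real_of_int (segre_bound s P m) * (real (vec.dim L) - 1)"
      using L by (simp add: pos_divide_le_eq)
    then have "real_of_int (int (weight L s P m) - 1) \<le> real_of_int (segre_bound s P m * (int (vec.dim L) - 1))"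
      by simp
    then show "int (weight L s P m) - 1 \<le> int (nat (segre_bound s P m)) * (int (vec.dim L) - 1)"
      using nonneg by (simp only: of_int_le_iff int_nat_eq if_True)
  qed
qed

theorem theorem5p3:
  fixes P :: "nat \<Rightarrow> 'k::field ^ 'v::finite" and m :: "nat \<Rightarrow> nat" and s :: nat
  assumes "CARD('v) \<ge> 2"
    and "fat_point_scheme s P m"
  shows "int (regularity_index s P m) \<le> segre_bound s P m"
proof -
  note segre = segre_bound_properties[OF assms]
  have "regularity_index s P m \<le> nat (segre_bound s P m)"
    unfolding regularity_index_def by (rule Least_le) (rule hilbert_function_fat_ideal[OF assms(2) segre(2) assms(1)])
  then show ?thesis using segre(1) by linarith
qed

end
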